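(* Let $c>0$ and $\alpha\ge0$ be real numbers. For any integer $n>\frac{ec+1}{2}$, $$|\mu_n^{(\alpha)}(c)|\le\frac{k_\alpha}{c^{\frac\alpha2+1}\log\left(\frac{2n-1}{ec}\right)}\left(\frac{ec}{2n-1}\right)^{n+\frac\alpha2},\qquad k_\alpha=\left(\frac2e\right)^{1+\frac\alpha2}\pi\,(\Gamma(\alpha+1))^{1/2},$$ and $$\lambda_n^{(\alpha)}(c)\le\frac{K_\alpha}{c^{\alpha+1}\log^2\left(\frac{2n-1}{ec}\right)}\left(\frac{ec}{2n-1}\right)^{2n+\alpha},\qquad K_\alpha=\frac\pi2\left(\frac2e\right)^{\alpha+2}\Gamma(\alpha+1).$$
   Context: Let $I=[-1,1]$ and $\omega_\alpha(y)=(1-y^2)^\alpha$. The weighted finite Fourier transform operator on $L^2(I,\omega_\alpha)$ is $$\mathcal F_c^{(\alpha)}f(x)=\int_{-1}^1e^{icxy}f(y)\,\omega_\alpha(y)\,dy .$$ It is compact, and its eigenvalues are denoted $\mu_n^{(\alpha)}(c)$, $n=0,1,2,\dots$, arranged so that $|\mu_0^{(\alpha)}(c)|\ge|\mu_1^{(\alpha)}(c)|\ge\cdots$. Let $\mathcal Q_c^{(\alpha)}=\frac{c}{2\pi}\,\mathcal F_c^{(\alpha)*}\mathcal F_c^{(\alpha)}$, where $*$ denotes the adjoint in $L^2(I,\omega_\alpha)$. It is positive, self-adjoint and compact, and its eigenvalues, in decreasing order, are $\lambda_n^{(\alpha)}(c)=\frac{c}{2\pi}|\mu_n^{(\alpha)}(c)|^2$,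 $n=0,1,2,\dots$. Here $e=\exp(1)$ and $\Gamma$ is the Gamma function. *)

theory Defs
  imports "HOL-Analysis.Analysis"
begin

(* For alpha = 0 the value at y = 1 and y = -1 is 0 powr 0 = 0 instead of 1, which only concerns
   a null set. *)
definition weight :: "real \<Rightarrow> real \<Rightarrow> real" where
  "weight \<alpha> y = (1 - y\<^sup>2) powr \<alpha>"

definition weighted_measure :: "real \<Rightarrow> real measure" where
  "weighted_measure \<alpha> = density lborel (\<lambda>y. ennreal (indicator {-1..1} y * weight \<alpha> y))"

(* The space L^2(I, weight). Its elements are represented by functions on the real line, to be read
   modulo equality almost everywhere with respect to weighted_measure, which lives on I = {-1..1}. *)
definition L2 :: "real \<Rightarrow> (real \<Rightarrow> complex) set" where
  "L2 \<alpha> = {f \<in> borel_measurable borel. integrable (weighted_measure \<alpha>) (\<lambda>y. (cmod (f y))\<^sup>2)}"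

definition L2_inner :: "real \<Rightarrow> (real \<Rightarrow> complex) \<Rightarrow> (real \<Rightarrow> complex) \<Rightarrow> complex" where
  "L2_inner \<alpha> f g = (LINT y|weighted_measure \<alpha>. f y * cnj (g y))"

(* The choice of the adjoint is unique up to equality almost everywhere of its values. *)
definition L2_adjoint ::
  "real \<Rightarrow> ((real \<Rightarrow> complex) \<Rightarrow> real \<Rightarrow> complex) \<Rightarrow> (real \<Rightarrow> complex) \<Rightarrow> real \<Rightarrow> complex" where
  "L2_adjoint \<alpha> T = (SOME S. (\<forall>g\<in>L2 \<alpha>. S g \<in> L2 \<alpha>) \<and>
     (\<forall>f\<in>L2 \<alpha>. \<forall>g\<in>L2 \<alpha>. L2_inner \<alpha> (T f) g = L2_inner \<alpha> f (S g)))"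

definition finite_fourier :: "real \<Rightarrow> real \<Rightarrow> (real \<Rightarrow> complex) \<Rightarrow> real \<Rightarrow> complex" where
  "finite_fourier \<alpha> c f x =
     (LINT y:{-1..1}|lborel. exp (\<i> * complex_of_real (c * x * y)) * f y * complex_of_real (weight \<alpha> y))"

definition Q_op :: "real \<Rightarrow> real \<Rightarrow> (real \<Rightarrow> complex) \<Rightarrow> real \<Rightarrow> complex" where
  "Q_op \<alpha> c f x =
     complex_of_real (c / (2 * pi)) * L2_adjoint \<alpha> (finite_fourier \<alpha> c) (finite_fourier \<alpha> c f) x"

definition eigenspace ::
  "real \<Rightarrow> ((real \<Rightarrow> complex) \<Rightarrow> real \<Rightarrow> complex) \<Rightarrow> complex \<Rightarrow> (real \<Rightarrow> complex) set" where
  "eigenspace \<alpha> T z = {f \<in> L2 \<alpha>. AE x in weighted_measure \<alpha>. T f x = z * f x}"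

(* The image of V in the space of classes modulo equality almost everywhere has a basis with d
   elements, over the complex numbers. *)
definition has_L2_dim :: "real \<Rightarrow> (real \<Rightarrow> complex) set \<Rightarrow> nat \<Rightarrow> bool" where
  "has_L2_dim \<alpha> V d \<longleftrightarrow> (\<exists>b :: nat \<Rightarrow> real \<Rightarrow> complex.
     (\<forall>k<d. b k \<in> V) \<and>
     (\<forall>a :: nat \<Rightarrow> complex.
        (AE x in weighted_measure \<alpha>. (\<Sum>k<d. a k * b k x) = 0) \<longrightarrow> (\<forall>k<d. a k = 0)) \<and>
     (\<forall>f\<in>V. \<exists>a :: nat \<Rightarrow> complex. AE x in weighted_measure \<alpha>. f x = (\<Sum>k<d. a k * b k x)))"

(* The sequence lists all eigenvalues of T on L^2(I, weight), each one as often as the dimension of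
   its eigenspace; in particular every value of the sequence is an eigenvalue. finite_fourier and Q_op are
   normal, so that geometric and algebraic multiplicities agree, and injective, so that 0 is not
   listed. *)
definition enumerates_eigenvalues ::
  "real \<Rightarrow> ((real \<Rightarrow> complex) \<Rightarrow> real \<Rightarrow> complex) \<Rightarrow> (nat \<Rightarrow> complex) \<Rightarrow> bool" where
  "enumerates_eigenvalues \<alpha> T \<mu> \<longleftrightarrow>
     (\<forall>z. finite {n. \<mu> n = z} \<and> has_L2_dim \<alpha> (eigenspace \<alpha> T z) (card {n. \<mu> n = z}))"

definition eigenvalues_finite_fourier :: "real \<Rightarrow> real \<Rightarrow> (nat \<Rightarrow> complex) \<Rightarrow> bool" where
  "eigenvalues_finite_fourier \<alpha> c \<mu> \<longleftrightarrow>
     enumerates_eigenvalues \<alpha> (finite_fourier \<alpha> c) \<mu> \<and> decseq (\<lambda>n. cmod (\<mu> n))"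

definition eigenvalues_Q_op :: "real \<Rightarrow> real \<Rightarrow> (nat \<Rightarrow> real) \<Rightarrow> bool" where
  "eigenvalues_Q_op \<alpha> c \<nu> \<longleftrightarrow>
     enumerates_eigenvalues \<alpha> (Q_op \<alpha> c) (\<lambda>n. complex_of_real (\<nu> n)) \<and> decseq \<nu>"

definition k_const :: "real \<Rightarrow> real" where
  "k_const \<alpha> = (2 / exp 1) powr (1 + \<alpha> / 2) * pi * Gamma (\<alpha> + 1) powr (1 / 2)"

definition K_const :: "real \<Rightarrow> real" where
  "K_const \<alpha> = pi / 2 * (2 / exp 1) powr (\<alpha> + 2) * Gamma (\<alpha> + 1)"

end

theory Submission
  imports Defs
begin

text \<open>
  Let \<open>F\<close> be the finite Fourier transform. Both bounds come from the min-max principle, applied to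
  \<open>\<parallel>F f\<parallel>\<^sup>2\<close> with the polynomials of degree less than \<open>n\<close> as test space.

  If \<open>f\<close> is orthogonal to the polynomials of degree less than \<open>n\<close>, then the exponential in \<open>F f x\<close>
  can be replaced by its difference from any such polynomial in \<open>y\<close>. Interpolation at the
  Chebyshev nodes makes the difference at most \<open>2 * (c * \<bar>x\<bar> / 2) ^ n / fact n\<close> on the interval
  (\<open>exp_poly_approx\<close>). By the Cauchy--Schwarz inequality, and since the moment of \<open>x ^ (2 * n)\<close> for
  the weight is at most \<open>Gamma (\<alpha> + 1) / (n - 1/2) powr (\<alpha> + 1)\<close> (\<open>even_moment_le\<close>), it follows that
  \<open>\<parallel>F f\<parallel>\<^sup>2 \<le> S * \<parallel>f\<parallel>\<^sup>2\<close> with an explicit number \<open>S\<close> (\<open>finite_fourier_norm_le\<close>).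

  On the other hand, \<open>n + 1\<close> independent eigenfunctions span a function \<open>f \<noteq> 0\<close> that satisfies the
  \<open>n\<close> conditions of orthogonality. Eigenfunctions for different eigenvalues are orthogonal: the
  adjoint of \<open>F\<close> is \<open>F\<close> with \<open>- c\<close> in place of \<open>c\<close>, that is, \<open>F\<close> followed by a reflection, which
  makes \<open>F\<close> normal; and \<open>Q\<close> is self-adjoint. Therefore \<open>\<parallel>F f\<parallel>\<^sup>2\<close> is at least
  \<open>\<bar>\<mu>\<^sub>n\<bar>\<^sup>2 * \<parallel>f\<parallel>\<^sup>2\<close>, and likewise at least \<open>2 * pi / c * \<nu>\<^sub>n * \<parallel>f\<parallel>\<^sup>2\<close> (\<open>eigenvalue_le\<close>). Hence both
  factors are at most \<open>S\<close>.

  It remains to see that \<open>S\<close> is at most the square of the first bound (\<open>squared_bound_ge\<close>). This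
  takes a lower bound of Stirling type for the factorial and the inequality \<open>q * ln (1 / q) \<le> 1\<close> for
  \<open>q = exp 1 * c / (2 * n - 1)\<close>. The second bound is the square of the first times
  \<open>c / (2 * pi)\<close>.
\<close>

section \<open>A lower bound for the factorial\<close>

text \<open>
  The midpoint form of the Hermite--Hadamard inequality for the concave function \<open>ln\<close>: the integral
  of \<open>ln\<close> over an interval of length one is at most the value at the midpoint, because the graph
  lies below its tangent there.
\<close>
lemma ln_midpoint_ge:
  fixes z :: real
  assumes "z > 0"
  shows "(z + 1) * ln (z + 1) - z * ln z \<le> 1 + ln (z + 1 / 2)"
proof -
  define s where "s = z + 1 / 2"
  have s: "s > 0" using assms by (simp add: s_def)
  \<comment> \<open>an antiderivative of \<open>ln\<close> minus its tangent at \<open>s\<close>\<close>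
  define \<phi> where "\<phi> t = t * ln t - t - (ln s * t + (t - s)\<^sup>2 / (2 * s))" for t
  have "\<phi> (z + 1) \<le> \<phi> z"
  proof (rule DERIV_nonpos_imp_nonincreasing[of z "z + 1" \<phi>])
    show "z \<le> z + 1" by simp
  next
    fix t assume t: "z \<le> t" "t \<le> z + 1"
    with assms have "t > 0" by linarith
    have "(\<phi> has_real_derivative ln t - ln s - (t - s) / s) (at t)"
      unfolding \<phi>_def using \<open>t > 0\<close> s
      by (auto intro!: derivative_eq_intros simp: field_simps)
    moreover have "ln (t / s) \<le> t / s - 1"
      using \<open>t > 0\<close> s by (intro ln_le_minus_one) simp
    then have "ln t - ln s - (t - s) / s \<le> 0"
      using \<open>t > 0\<close> s by (simp add: ln_div diff_divide_distrib)
    ultimately show "\<exists>y. (\<phi> has_real_derivative y) (at t) \<and> y \<le> 0"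
      by blast
  qed
  moreover have "(z + 1 - s)\<^sup>2 = (z - s)\<^sup>2"
    by (simp add: s_def power2_eq_square)
  ultimately show ?thesis
    by (simp add: \<phi>_def s_def algebra_simps)
qed

text \<open>
  With the shift by one half the quotient of the factorial and the Stirling term increases, so
  that its value at zero bounds it from below.
\<close>
lemma ln_fact_ge:
  "ln (fact n :: real) \<ge> (1 + ln 2) / 2 + (real n + 1 / 2) * (ln (real n + 1 / 2) - 1)"
proof (induction n)
  case 0
  show ?case by (simp add: ln_div diff_divide_distrib add_divide_distrib)
next
  case (Suc n)
  have "ln (fact (Suc n) :: real) = ln (real n + 1) + ln (fact n)"
    by (simp add: ln_mult add.commute)
  then show ?case
    using Suc ln_midpoint_ge[of "real n + 1 / 2"] by (simp add: algebra_simps)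
qed

lemma fact_squared_ge:
  assumes "n \<ge> 1"
  shows "(fact n :: real)\<^sup>2 \<ge> 2 * (real n - 1 / 2) * ((real n - 1 / 2) / exp 1) ^ (2 * n)"
proof -
  define m where "m = real n - 1 / 2"
  have m: "m > 0" using assms by (simp add: m_def)
  have "ln (2 * m * (m / exp 1) ^ (2 * n)) = ln 2 + ln m + 2 * real n * (ln m - 1)"
    using m by (simp add: ln_mult ln_div ln_realpow)
  also have "\<dots> = ln 2 + (2 * real n + 1) * ln m - 2 * real n"
    by (simp add: algebra_simps)
  also have "\<dots> \<le> ln 2 + (2 * real n + 1) * ln (real n + 1 / 2) - 2 * real n"
    using m by (intro diff_right_mono add_left_mono mult_left_mono) (simp_all add: m_def)
  also have "\<dots> \<le> 2 * ln (fact n)"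
    using ln_fact_ge[of n] by (simp add: field_simps)
  also have "\<dots> = ln ((fact n)\<^sup>2)"
    by (simp add: ln_realpow)
  finally show ?thesis
    using m unfolding m_def[symmetric] by (subst (asm) ln_le_cancel_iff) simp_all
qed


section \<open>Chebyshev approximation of exponentials\<close>

text \<open>The iterated form of Rolle's theorem that gives the remainder of interpolation.\<close>
lemma iterated_Rolle:
  fixes D :: "nat \<Rightarrow> real \<Rightarrow> real"
  assumes deriv: "\<And>k x. (D k has_real_derivative D (Suc k) x) (at x)"
    and "finite Z" "card Z = Suc n" "\<And>z. z \<in> Z \<Longrightarrow> D j z = 0"
  shows "\<exists>\<xi>. D (j + n) \<xi> = 0"
  using assms(2-)
proof (induction n arbitrary: Z j)
  case 0
  then obtain z where "z \<in> Z" by fastforce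
  with 0 show ?case by auto
next
  case (Suc n)
  define xs where "xs = sorted_list_of_set Z"
  have xs: "sorted_wrt (<) xs" "set xs = Z" "length xs = Suc (Suc n)"
    using Suc.prems strict_sorted_list_of_set[of Z] by (simp_all add: xs_def)
  have less: "xs ! i < xs ! k" if "i < k" "k < Suc (Suc n)" for i k
    using sorted_wrt_nth_less[OF xs(1) that(1)] that xs(3) by simp
  have zero: "D j (xs ! i) = 0" if "i < Suc (Suc n)" for i
    using that xs by (intro Suc.prems(3)) (metis nth_mem)
  have "\<exists>w. xs ! i < w \<and> w < xs ! Suc i \<and> D (Suc j) w = 0" if i: "i < Suc n" for i
  proof -
    have lt: "xs ! i < xs ! Suc i" using less i by simp
    have "\<exists>w. xs ! i < w \<and> w < xs ! Suc i \<and> (D j has_real_derivative 0) (at w)"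
    proof (rule Rolle[OF lt])
      show "D j (xs ! i) = D j (xs ! Suc i)" using zero i by simp
      show "continuous_on {xs ! i..xs ! Suc i} (D j)"
        using deriv DERIV_isCont continuous_at_imp_continuous_on by blast
      show "D j differentiable at x" for x
        using deriv real_differentiable_def by blast
    qed
    then show ?thesis using deriv DERIV_unique by blast
  qed
  then obtain w where w: "\<And>i. i < Suc n \<Longrightarrow> xs ! i < w i \<and> w i < xs ! Suc i \<and> D (Suc j) (w i) = 0"
    by metis
  have "inj_on w {..<Suc n}"
  proof (rule linorder_inj_onI)
    fix i k assume ik: "i < k" "i \<in> {..<Suc n}" "k \<in> {..<Suc n}"
    then have "xs ! Suc i \<le> xs ! k"
      using less[of "Suc i" k] by (cases "Suc i = k") auto
    then show "w i \<noteq> w k"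
      using w[of i] w[of k] ik by fastforce
  qed auto
  then have "card (w ` {..<Suc n}) = Suc n" by (simp add: card_image)
  with Suc.IH[of "w ` {..<Suc n}" "Suc j"] w show ?case by auto
qed

text \<open>
  Newton's form: each further node adds a multiple of the polynomial that vanishes at the earlier
  ones. The bound on the degree is expressed by coefficients, so that it also covers the case
  without nodes.
\<close>
lemma interpolation_poly_exists:
  fixes h :: "'a :: field \<Rightarrow> 'a"
  assumes "finite Z"
  shows "\<exists>p. (\<forall>k\<ge>card Z. coeff p k = 0) \<and> (\<forall>z\<in>Z. poly p z = h z)"
  using assms
proof (induction Z rule: finite_induct)
  case empty
  show ?case by (rule exI[of _ 0]) simp
next
  case (insert x Z)
  then obtain p where p: "\<forall>k\<ge>card Z. coeff p k = 0" "\<forall>z\<in>Z. poly p z = h z" by blast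
  define W where "W = (\<Prod>z\<in>Z. [:- z, 1:])"
  have Wx: "poly W x \<noteq> 0" and Wz: "\<forall>z\<in>Z. poly W z = 0" and deg: "degree W \<le> card Z"
    using insert degree_prod_sum_le[of Z "\<lambda>z. [:- z, 1:]"] by (auto simp: W_def poly_prod)
  let ?q = "p + smult ((h x - poly p x) / poly W x) W"
  have "coeff ?q k = 0" if "k \<ge> card (insert x Z)" for k
    using that insert p deg by (simp add: coeff_eq_0)
  moreover have "poly ?q z = h z" if "z \<in> insert x Z" for z
    using that p Wx Wz by auto
  ultimately show ?case by blast
qed

text \<open>The Chebyshev polynomials of the first kind, through their three-term recurrence.\<close>
fun chebyshev :: "nat \<Rightarrow> real poly" where
  "chebyshev 0 = 1"
| "chebyshev (Suc 0) = [:0, 1:]"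
| "chebyshev (Suc (Suc n)) = smult 2 (pCons 0 (chebyshev (Suc n))) - chebyshev n"

lemma poly_chebyshev_cos: "poly (chebyshev n) (cos \<theta>) = cos (real n * \<theta>)"
proof (induction n rule: chebyshev.induct)
  case (3 n)
  have "2 * cos \<theta> * cos (real (Suc n) * \<theta>) = cos (real (Suc (Suc n)) * \<theta>) + cos (real n * \<theta>)"
    using cos_add[of "real (Suc n) * \<theta>" \<theta>] cos_diff[of "real (Suc n) * \<theta>" \<theta>]
    by (simp add: algebra_simps)
  with 3 show ?case by (simp add: algebra_simps)
qed simp_all

lemma coeff_chebyshev_eq_0: "k > n \<Longrightarrow> coeff (chebyshev n) k = 0"
  by (induction n arbitrary: k rule: chebyshev.induct) (auto simp: coeff_pCons split: nat.splits)

lemma coeff_chebyshev_Suc: "coeff (chebyshev (Suc n)) (Suc n) = 2 ^ n"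
  by (induction n) (simp_all add: coeff_chebyshev_eq_0)

lemma poly_chebyshev_bound:
  assumes "\<bar>y\<bar> \<le> 1"
  shows "\<bar>poly (chebyshev n) y\<bar> \<le> 1"
  using poly_chebyshev_cos[of n "arccos y"] assms by (simp add: abs_le_iff)

lemma chebyshev_roots:
  "\<exists>Z. finite Z \<and> card Z = n \<and> (\<forall>z\<in>Z. poly (chebyshev n) z = 0)"
proof (cases "n = 0")
  case False
  define \<theta> where "\<theta> j = (2 * real j + 1) * pi / (2 * real n)" for j
  have range: "0 \<le> \<theta> j" "\<theta> j \<le> pi" if "j < n" for j
  proof -
    have "2 * real j + 1 \<le> 2 * real n" using that by simp
    then have "pi * (2 * real j + 1) \<le> pi * (2 * real n)" by (intro mult_left_mono) simp_all
    with that show "0 \<le> \<theta> j" "\<theta> j \<le> pi" by (simp_all add: \<theta>_def field_simps)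
  qed
  have "inj_on (\<lambda>j. cos (\<theta> j)) {..<n}"
  proof (rule inj_onI)
    fix i j assume ij: "i \<in> {..<n}" "j \<in> {..<n}" "cos (\<theta> i) = cos (\<theta> j)"
    then have "\<theta> i = \<theta> j" using range[of i] range[of j] cos_inj_pi[of "\<theta> i" "\<theta> j"] by blast
    then show "i = j" using False by (simp add: \<theta>_def)
  qed
  then have "card ((\<lambda>j. cos (\<theta> j)) ` {..<n}) = n" by (simp add: card_image)
  moreover have "poly (chebyshev n) (cos (\<theta> j)) = 0" for j
  proof -
    have "real n * \<theta> j = pi / 2 + real j * pi"
      using False by (simp add: \<theta>_def field_simps)
    then show ?thesis by (simp add: poly_chebyshev_cos cos_add)
  qed
  ultimately show ?thesis by (intro exI[of _ "(\<lambda>j. cos (\<theta> j)) ` {..<n}"]) auto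
qed auto

lemma higher_pderiv_chebyshev:
  assumes "n \<ge> 1"
  shows "poly ((pderiv ^^ n) (chebyshev n)) x = 2 ^ (n - 1) * fact n"
proof -
  obtain m where n: "n = Suc m" using assms by (cases n) auto
  have "coeff ((pderiv ^^ n) (chebyshev n)) k = coeff [:2 ^ m * fact n:] k" for k
  proof (cases k)
    case 0
    then show ?thesis
      using coeff_chebyshev_Suc[of m] by (simp add: coeff_higher_pderiv n pochhammer_fact del: funpow.simps)
  next
    case (Suc j)
    then show ?thesis
      by (simp add: coeff_chebyshev_eq_0 coeff_higher_pderiv del: funpow.simps)
  qed
  then have "(pderiv ^^ n) (chebyshev n) = [:2 ^ m * fact n:]" by (intro poly_eqI)
  then show ?thesis by (simp add: n)
qed

text \<open>
  The successive derivatives of a rotated interpolation error, restricted to the real line, in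
  the form in which iterated Rolle needs them.
\<close>
lemma has_real_derivative_Re_exp_minus_poly:
  "((\<lambda>s. Re (u * (\<i> * of_real t) ^ k * exp (\<i> * of_real (t * s)) - u * poly ((pderiv ^^ k) p) (of_real s)))
     has_real_derivative
     Re (u * (\<i> * of_real t) ^ Suc k * exp (\<i> * of_real (t * s))
         - u * poly ((pderiv ^^ Suc k) p) (of_real s))) (at s)"
proof -
  let ?G = "\<lambda>z. u * (\<i> * of_real t) ^ k * exp (\<i> * of_real t * z) - u * poly ((pderiv ^^ k) p) z"
  have "(?G has_field_derivative
     u * (\<i> * of_real t) ^ Suc k * exp (\<i> * of_real t * z) - u * poly ((pderiv ^^ Suc k) p) z) (at z)" for z
    by (auto intro!: derivative_eq_intros simp: algebra_simps)
  then have "((\<lambda>s. ?G (of_real s)) has_vector_derivative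
     u * (\<i> * of_real t) ^ Suc k * exp (\<i> * of_real t * of_real s)
     - u * poly ((pderiv ^^ Suc k) p) (of_real s)) (at s)"
    by (rule has_vector_derivative_real_field)
  from bounded_linear.has_vector_derivative[OF bounded_linear_Re this]
  show ?thesis
    by (simp add: has_real_derivative_iff_has_vector_derivative mult.assoc)
qed

text \<open>
  Interpolation at the Chebyshev nodes. The bound gains the factor \<open>2 / 2 ^ n\<close> over
  Taylor approximation. Interpolation concerns complex values, while Rolle's theorem
  is real; it is applied to the real part after a rotation \<open>u\<close> that makes the error at
  the point under consideration a nonnegative real number.
\<close>
lemma exp_poly_approx:
  fixes t :: real
  assumes "n \<ge> 1"
  shows "\<exists>a :: nat \<Rightarrow> complex. \<forall>y. \<bar>y\<bar> \<le> 1 \<longrightarrow>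
     cmod (exp (\<i> * of_real (t * y)) - (\<Sum>j<n. a j * of_real y ^ j)) \<le> 2 * (\<bar>t\<bar> / 2) ^ n / fact n"
proof -
  obtain Z where Z: "finite Z" "card Z = n" "\<And>z. z \<in> Z \<Longrightarrow> poly (chebyshev n) z = 0"
    using chebyshev_roots by blast
  have "card (of_real ` Z :: complex set) = n"
    using Z(2) by (simp add: card_image inj_on_def)
  then obtain p :: "complex poly" where p: "\<And>k. k \<ge> n \<Longrightarrow> coeff p k = 0"
      "\<And>z. z \<in> Z \<Longrightarrow> poly p (of_real z) = exp (\<i> * of_real (t * z))"
    using interpolation_poly_exists[of "of_real ` Z :: complex set" "\<lambda>z. exp (\<i> * of_real t * z)"] Z(1)
    by (auto simp: mult.assoc)
  have poly_p: "poly p w = (\<Sum>j<n. coeff p j * w ^ j)" for w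
  proof -
    have "poly p w = (\<Sum>j\<le>degree p. coeff p j * w ^ j)" by (rule poly_altdef)
    also have "\<dots> = (\<Sum>j\<le>max n (degree p). coeff p j * w ^ j)"
      by (rule sum.mono_neutral_left) (auto simp: coeff_eq_0)
    also have "\<dots> = (\<Sum>j<n. coeff p j * w ^ j)"
      by (rule sum.mono_neutral_right) (auto simp: p)
    finally show ?thesis .
  qed
  have high: "(pderiv ^^ n) p = 0"
    by (intro poly_eqI) (simp add: coeff_higher_pderiv p)
  have "cmod (exp (\<i> * of_real (t * y)) - poly p (of_real y)) \<le> 2 * (\<bar>t\<bar> / 2) ^ n / fact n"
    if y: "\<bar>y\<bar> \<le> 1" for y
  proof (cases "poly (chebyshev n) y = 0")
    case True
    \<comment> \<open>the polynomial of degree \<open>n\<close> has no roots besides the \<open>n\<close> nodes\<close>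
    have "y \<in> Z"
    proof (rule ccontr)
      assume "y \<notin> Z"
      then have 1: "card (insert y Z) = Suc n" using Z by simp
      have "chebyshev n \<noteq> 0"
        using higher_pderiv_chebyshev[OF assms] by auto
      moreover have "degree (chebyshev n) \<le> n"
        using coeff_chebyshev_eq_0[of n] by (intro degree_le) auto
      ultimately have "card {x. poly (chebyshev n) x = 0} \<le> n"
        using card_poly_roots_bound order_trans by blast
      moreover have "card (insert y Z) \<le> card {x. poly (chebyshev n) x = 0}"
        using True Z \<open>chebyshev n \<noteq> 0\<close> by (intro card_mono poly_roots_finite) auto
      ultimately show False using 1 by simp
    qed
    then show ?thesis using p(2) by simp
  next
    case False
    define E where "E = exp (\<i> * of_real (t * y)) - poly p (of_real y)"
    define u where "u = (if E = 0 then 1 else cnj E / of_real (cmod E))"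
    have u: "cmod u = 1" "u * E = of_real (cmod E)"
      using complex_norm_square[of E]
      by (auto simp: u_def norm_divide power2_eq_square field_simps)
    \<comment> \<open>the multiple of the Chebyshev polynomial that makes \<open>y\<close> a further zero of the error\<close>
    define K where "K = cmod E / poly (chebyshev n) y"
    define D where "D k s = Re (u * (\<i> * of_real t) ^ k * exp (\<i> * of_real (t * s))
      - u * poly ((pderiv ^^ k) p) (of_real s)) - K * poly ((pderiv ^^ k) (chebyshev n)) s" for k s
    have deriv: "(D k has_real_derivative D (Suc k) s) (at s)" for k s
      unfolding D_def
      by (intro DERIV_diff has_real_derivative_Re_exp_minus_poly DERIV_cmult) simp
    have "y \<notin> Z" using False Z by auto
    then have "card (insert y Z) = Suc n" using Z by simp
    moreover have "D 0 s = 0" if "s \<in> insert y Z" for s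
    proof (cases "s = y")
      case True
      have "D 0 y = Re (u * E) - K * poly (chebyshev n) y"
        by (simp add: D_def E_def algebra_simps)
      with True u False show ?thesis by (simp add: K_def)
    qed (use that Z p(2) in \<open>auto simp: D_def\<close>)
    ultimately obtain \<xi> where "D n \<xi> = 0"
      using iterated_Rolle[of D "insert y Z" n 0] deriv Z(1) by auto
    then have "K * (2 ^ (n - 1) * fact n) = Re (u * (\<i> * of_real t) ^ n * exp (\<i> * of_real (t * \<xi>)))"
      by (simp add: D_def high higher_pderiv_chebyshev[OF assms])
    then have "\<bar>K * (2 ^ (n - 1) * fact n)\<bar> \<le> cmod (u * (\<i> * of_real t) ^ n * exp (\<i> * of_real (t * \<xi>)))"
      by (simp only: abs_Re_le_cmod)
    also have "\<dots> = \<bar>t\<bar> ^ n"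
      by (simp add: norm_mult norm_power u)
    finally have "\<bar>K\<bar> \<le> \<bar>t\<bar> ^ n / (2 ^ (n - 1) * fact n)"
      by (simp add: abs_mult field_simps)
    moreover have "cmod E = \<bar>K\<bar> * \<bar>poly (chebyshev n) y\<bar>"
      using False by (simp add: K_def)
    moreover have "\<dots> \<le> \<bar>K\<bar> * 1"
      using poly_chebyshev_bound[OF y] by (intro mult_left_mono) auto
    moreover have "\<bar>t\<bar> ^ n / (2 ^ (n - 1) * fact n) = 2 * (\<bar>t\<bar> / 2) ^ n / fact n"
      using assms by (cases n) (simp_all add: power_divide)
    ultimately show ?thesis by (simp add: E_def)
  qed
  then show ?thesis unfolding poly_p by blast
qed


section \<open>The weighted measure\<close>

lemma borel_measurable_weight [measurable]: "weight \<alpha> \<in> borel_measurable borel"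
  unfolding weight_def by measurable

lemma weight_nonneg: "weight \<alpha> y \<ge> 0"
  by (simp add: weight_def)

lemma weight_le_1:
  assumes "\<alpha> \<ge> 0" "\<bar>y\<bar> \<le> 1"
  shows "weight \<alpha> y \<le> 1"
  using assms by (auto simp: weight_def abs_square_le_1 intro!: powr_le1)

lemma sets_weighted_measure [measurable_cong, simp]: "sets (weighted_measure \<alpha>) = sets borel"
  by (simp add: weighted_measure_def)

lemma space_weighted_measure [simp]: "space (weighted_measure \<alpha>) = UNIV"
  by (simp add: weighted_measure_def)

lemma nn_integral_weighted_measure:
  assumes [measurable]: "h \<in> borel_measurable borel"
  shows "(\<integral>\<^sup>+y. h y \<partial>weighted_measure \<alpha>)
    = (\<integral>\<^sup>+y. ennreal (indicator {-1..1} y * weight \<alpha> y) * h y \<partial>lborel)"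
  unfolding weighted_measure_def by (subst nn_integral_density) simp_all

lemma integral_weighted_measure:
  fixes h :: "real \<Rightarrow> 'b :: {banach, second_countable_topology}"
  assumes [measurable]: "h \<in> borel_measurable borel"
  shows "(LINT y|weighted_measure \<alpha>. h y)
    = (LINT y|lborel. (indicator {-1..1} y * weight \<alpha> y) *\<^sub>R h y)"
  unfolding weighted_measure_def
  by (subst integral_density) (auto simp: weight_nonneg)

lemma AE_weighted_measure_interval: "AE y in weighted_measure \<alpha>. \<bar>y\<bar> \<le> 1"
  unfolding weighted_measure_def
  by (subst AE_density) (auto intro!: AE_I2 simp: abs_le_iff split: split_indicator_asm)

lemma integral_weighted_measure_reflect:
  fixes h :: "real \<Rightarrow> 'b :: {banach, second_countable_topology}"
  assumes [measurable]: "h \<in> borel_measurable borel"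
  shows "(LINT y|weighted_measure \<alpha>. h (- y)) = (LINT y|weighted_measure \<alpha>. h y)"
proof -
  have "(LINT y|weighted_measure \<alpha>. h y)
      = \<bar>- 1\<bar> *\<^sub>R (LINT y|lborel. (indicator {-1..1} (0 + - 1 * y) * weight \<alpha> (0 + - 1 * y)) *\<^sub>R h (0 + - 1 * y))"
    by (subst integral_weighted_measure[OF assms], rule lborel_integral_real_affine) simp
  also have "\<dots> = (LINT y|weighted_measure \<alpha>. h (- y))"
    by (subst integral_weighted_measure) (auto simp: weight_def indicator_def intro!: Bochner_Integration.integral_cong)
  finally show ?thesis by simp
qed

lemma emeasure_weighted_measure_le:
  assumes "\<alpha> \<ge> 0"
  shows "emeasure (weighted_measure \<alpha>) UNIV \<le> 2"
proof -
  have "emeasure (weighted_measure \<alpha>) UNIV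
      = (\<integral>\<^sup>+y. ennreal (indicator {-1..1} y * weight \<alpha> y) * 1 \<partial>lborel)"
    using nn_integral_weighted_measure[of "\<lambda>_. 1" \<alpha>] by simp
  also have "\<dots> \<le> (\<integral>\<^sup>+y. indicator {-1..1::real} y \<partial>lborel)"
    using weight_le_1[OF assms]
    by (intro nn_integral_mono) (auto simp: abs_le_iff split: split_indicator)
  finally show ?thesis by simp
qed

lemma finite_measure_weighted_measure:
  assumes "\<alpha> \<ge> 0"
  shows "finite_measure (weighted_measure \<alpha>)"
  using emeasure_weighted_measure_le[OF assms]
  by (intro finite_measureI) (auto simp: top_unique)

text \<open>
  The substitution \<open>s = m * (1 - y\<^sup>2)\<close> turns the moment into a part of the integral for
  \<open>Gamma (\<alpha> + 1)\<close>, since \<open>(y\<^sup>2) powr m \<le> exp (- m * (1 - y\<^sup>2))\<close>. One power of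
  \<open>\<bar>y\<bar>\<close> goes into the derivative of \<open>s\<close>, which is why \<open>m\<close> is half of an odd number.
\<close>
lemma even_moment_half_le:
  fixes n :: nat
  assumes "n \<ge> 1" "\<alpha> \<ge> 0"
  defines "m \<equiv> real n - 1 / 2"
  shows "(\<integral>\<^sup>+y. ennreal (indicator {-1..0} y * (y ^ (2 * n) * weight \<alpha> y)) \<partial>lborel)
    \<le> ennreal (Gamma (\<alpha> + 1) * m powr (- \<alpha> - 1) / 2)"
proof -
  have m: "m > 0" using assms by (simp add: m_def)
  define f where "f s = s powr \<alpha> / exp s" for s :: real
  define g where "g y = m * (1 - y\<^sup>2)" for y :: real
  define C where "C = m powr (- \<alpha> - 1) / 2"
  have pw: "y ^ (2 * n) * weight \<alpha> y \<le> C * (f (g y) * (- 2 * m * y))" if y: "-1 \<le> y" "y \<le> 0" for y :: real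
  proof -
    have u: "1 - y\<^sup>2 \<ge> 0" using y by (simp add: abs_square_le_1 abs_le_iff)
    have "(y\<^sup>2) ^ (2 * n - 1) \<le> exp (- (1 - y\<^sup>2)) ^ (2 * n - 1)"
      using exp_ge_add_one_self[of "- (1 - y\<^sup>2)"] by (intro power_mono) simp_all
    also have "\<dots> = exp (- m * (1 - y\<^sup>2)) ^ 2"
      using assms(1) by (simp add: exp_of_nat_mult[symmetric] m_def of_nat_diff algebra_simps)
    finally have "(\<bar>y\<bar> ^ (2 * n - 1))\<^sup>2 \<le> exp (- m * (1 - y\<^sup>2)) ^ 2"
      by (metis power2_abs power_even_eq power_mult mult.commute)
    then have e: "\<bar>y\<bar> ^ (2 * n - 1) \<le> exp (- m * (1 - y\<^sup>2))"
      by (rule power2_le_imp_le) simp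
    have "y ^ (2 * n) = \<bar>y\<bar> ^ (2 * n)" by (simp add: power_even_abs)
    also have "\<dots> = \<bar>y\<bar> * \<bar>y\<bar> ^ (2 * n - 1)"
      using assms(1) by (cases n) simp_all
    also have "\<dots> \<le> \<bar>y\<bar> * exp (- m * (1 - y\<^sup>2))"
      using e by (rule mult_left_mono) simp
    also have "\<dots> = - y * exp (- m * (1 - y\<^sup>2))"
      using y by simp
    finally have "y ^ (2 * n) * weight \<alpha> y \<le> - y * exp (- m * (1 - y\<^sup>2)) * weight \<alpha> y"
      by (intro mult_right_mono weight_nonneg)
    also have "\<dots> = C * (m powr \<alpha> * (1 - y\<^sup>2) powr \<alpha> * exp (- m * (1 - y\<^sup>2)) * (- 2 * m * y))"
      using m by (simp add: C_def weight_def powr_diff powr_minus)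
    also have "m powr \<alpha> * (1 - y\<^sup>2) powr \<alpha> * exp (- m * (1 - y\<^sup>2)) = f (g y)"
      using m u by (simp add: f_def g_def powr_mult exp_minus divide_inverse)
    finally show ?thesis .
  qed
  have C: "C \<ge> 0" by (simp add: C_def)
  have fm [measurable]: "f \<in> borel_measurable borel"
    unfolding f_def by measurable
  have "(\<integral>\<^sup>+y. ennreal (indicator {-1..0} y * (y ^ (2 * n) * weight \<alpha> y)) \<partial>lborel)
    \<le> (\<integral>\<^sup>+y. ennreal C * ennreal (f (g y) * (- 2 * m * y) * indicator {-1..0} y) \<partial>lborel)"
  proof (rule nn_integral_mono)
    show "ennreal (indicator {-1..0} y * (y ^ (2 * n) * weight \<alpha> y))
        \<le> ennreal C * ennreal (f (g y) * (- 2 * m * y) * indicator {-1..0} y)" for y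
      using pw[of y] C by (auto simp: ennreal_mult'[symmetric] intro!: ennreal_leI split: split_indicator)
  qed
  also have "\<dots> = ennreal C * (\<integral>\<^sup>+y. ennreal (f (g y) * (- 2 * m * y) * indicator {-1..0} y) \<partial>lborel)"
    by (rule nn_integral_cmult) (unfold g_def, measurable)
  also have "(\<integral>\<^sup>+y. ennreal (f (g y) * (- 2 * m * y) * indicator {-1..0} y) \<partial>lborel)
     = (\<integral>\<^sup>+s. ennreal (f s * indicator {g (-1)..g 0} s) \<partial>lborel)"
  proof (rule nn_integral_substitution[symmetric])
    show "set_borel_measurable borel {g (-1)..g 0} f"
      unfolding set_borel_measurable_def by measurable
    show "(g has_real_derivative - 2 * m * x) (at x)" for x
      unfolding g_def by (auto intro!: derivative_eq_intros)
  qed (use m in \<open>auto intro!: continuous_intros simp: mult_nonneg_nonpos\<close>)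
  also have "\<dots> \<le> (\<integral>\<^sup>+s. ennreal (indicator {0..} s * s powr (\<alpha> + 1 - 1) / exp s) \<partial>lborel)"
    by (intro nn_integral_mono) (auto simp: f_def g_def split: split_indicator)
  also have "\<dots> = ennreal (Gamma (\<alpha> + 1))"
    using assms by (subst Gamma_conv_nn_integral_real) simp_all
  finally have "(\<integral>\<^sup>+y. ennreal (indicator {-1..0} y * (y ^ (2 * n) * weight \<alpha> y)) \<partial>lborel)
    \<le> ennreal C * ennreal (Gamma (\<alpha> + 1))"
    by (simp add: mult_left_mono)
  also have "\<dots> = ennreal (Gamma (\<alpha> + 1) * m powr (- \<alpha> - 1) / 2)"
    using C by (subst ennreal_mult'[symmetric]) (simp_all add: C_def mult.commute)
  finally show ?thesis .
qed

lemma even_moment_le: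
  assumes "n \<ge> 1" "\<alpha> \<ge> 0"
  shows "(LINT y|weighted_measure \<alpha>. y ^ (2 * n)) \<le> Gamma (\<alpha> + 1) * (real n - 1 / 2) powr (- \<alpha> - 1)"
proof (rule integral_real_bounded)
  let ?m = "real n - 1 / 2"
  let ?k = "\<lambda>y. y ^ (2 * n) * weight \<alpha> y"
  show "Gamma (\<alpha> + 1) * ?m powr (- \<alpha> - 1) \<ge> 0"
    using assms Gamma_real_pos[of "\<alpha> + 1"] by simp
  have "(\<integral>\<^sup>+y. ennreal (y ^ (2 * n)) \<partial>weighted_measure \<alpha>)
      = (\<integral>\<^sup>+y. ennreal (indicator {-1..1} y * ?k y) \<partial>lborel)"
    by (subst nn_integral_weighted_measure)
       (auto intro!: nn_integral_cong simp: ennreal_mult'[symmetric] weight_nonneg mult.commute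
         split: split_indicator)
  also have "\<dots> \<le> (\<integral>\<^sup>+y. ennreal (indicator {-1..0} y * ?k y) + ennreal (indicator {0..1} y * ?k y) \<partial>lborel)"
    by (intro nn_integral_mono) (auto split: split_indicator)
  also have "\<dots> = (\<integral>\<^sup>+y. ennreal (indicator {-1..0} y * ?k y) \<partial>lborel)
      + (\<integral>\<^sup>+y. ennreal (indicator {0..1} y * ?k y) \<partial>lborel)"
    by (rule nn_integral_add) simp_all
  also have "(\<integral>\<^sup>+y. ennreal (indicator {0..1} y * ?k y) \<partial>lborel)
      = (\<integral>\<^sup>+y. ennreal (indicator {-1..0} y * ?k y) \<partial>lborel)"
    by (subst nn_integral_real_affine[where c = "-1" and t = 0])
       (auto intro!: nn_integral_cong simp: weight_def split: split_indicator)
  also have "\<dots> + \<dots> \<le> ennreal (Gamma (\<alpha> + 1) * ?m powr (- \<alpha> - 1) / 2)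
      + ennreal (Gamma (\<alpha> + 1) * ?m powr (- \<alpha> - 1) / 2)"
    using even_moment_half_le[OF assms] by (intro add_mono)
  also have "\<dots> = ennreal (Gamma (\<alpha> + 1) * ?m powr (- \<alpha> - 1))"
    using assms Gamma_real_pos[of "\<alpha> + 1"] by (subst ennreal_plus[symmetric]) auto
  finally show "(\<integral>\<^sup>+y. ennreal (y ^ (2 * n)) \<partial>weighted_measure \<alpha>)
      \<le> ennreal (Gamma (\<alpha> + 1) * ?m powr (- \<alpha> - 1))" .
qed

text \<open>
  The Cauchy--Schwarz inequality against a constant, read off from the nonnegative integral of
  \<open>(2 * u - A)\<^sup>2\<close>, where \<open>A\<close> is the integral of \<open>u\<close> and 2 bounds the total mass.
\<close>
lemma square_integral_le:
  fixes u :: "real \<Rightarrow> real"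
  assumes \<alpha>: "\<alpha> \<ge> 0" and u: "integrable (weighted_measure \<alpha>) u" "integrable (weighted_measure \<alpha>) (\<lambda>y. (u y)\<^sup>2)"
  shows "(LINT y|weighted_measure \<alpha>. u y)\<^sup>2 \<le> 2 * (LINT y|weighted_measure \<alpha>. (u y)\<^sup>2)"
proof -
  interpret finite_measure "weighted_measure \<alpha>" by (rule finite_measure_weighted_measure[OF \<alpha>])
  define A where "A = (LINT y|weighted_measure \<alpha>. u y)"
  have M: "measure (weighted_measure \<alpha>) UNIV \<le> 2"
    using emeasure_weighted_measure_le[OF \<alpha>] by (simp add: emeasure_eq_measure flip: ennreal_numeral)
  have "0 \<le> (LINT y|weighted_measure \<alpha>. (2 * u y - A)\<^sup>2)"
    by (rule integral_nonneg_AE) simp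
  also have "\<dots> = (LINT y|weighted_measure \<alpha>. 4 * (u y)\<^sup>2 - 4 * A * u y + A\<^sup>2)"
    by (simp add: power2_eq_square algebra_simps)
  also have "\<dots> = 4 * (LINT y|weighted_measure \<alpha>. (u y)\<^sup>2) - 4 * A * A + A\<^sup>2 * measure (weighted_measure \<alpha>) UNIV"
    using u by (simp add: A_def)
  also have "\<dots> \<le> 4 * (LINT y|weighted_measure \<alpha>. (u y)\<^sup>2) - 4 * A * A + A\<^sup>2 * 2"
    using M by (intro add_left_mono mult_left_mono) simp_all
  finally show ?thesis by (simp add: A_def power2_eq_square)
qed


section \<open>The Hilbert space\<close>

context
  fixes \<alpha> :: real
  assumes \<alpha>: "\<alpha> \<ge> 0"
begin

interpretation finite_measure "weighted_measure \<alpha>"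
  by (rule finite_measure_weighted_measure[OF \<alpha>])

interpretation pair_sigma_finite "weighted_measure \<alpha>" "weighted_measure \<alpha>" ..

lemma borel_measurable_cnj [measurable]: "cnj \<in> borel_measurable borel"
  by (intro borel_measurable_continuous_onI continuous_intros)

lemma L2_measurable: "f \<in> L2 \<alpha> \<Longrightarrow> f \<in> borel_measurable borel"
  by (simp add: L2_def)

lemma L2_square_integrable: "f \<in> L2 \<alpha> \<Longrightarrow> integrable (weighted_measure \<alpha>) (\<lambda>y. (cmod (f y))\<^sup>2)"
  by (simp add: L2_def)

lemma L2_product_integrable:
  assumes f: "f \<in> L2 \<alpha>" and g: "g \<in> L2 \<alpha>"
  shows "integrable (weighted_measure \<alpha>) (\<lambda>y. f y * cnj (g y))"
proof (rule Bochner_Integration.integrable_bound)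
  show "integrable (weighted_measure \<alpha>) (\<lambda>y. (cmod (f y))\<^sup>2 + (cmod (g y))\<^sup>2)"
    using assms by (intro Bochner_Integration.integrable_add L2_square_integrable)
  have [measurable]: "f \<in> borel_measurable borel" "g \<in> borel_measurable borel"
    using assms by (simp_all add: L2_measurable)
  show "(\<lambda>y. f y * cnj (g y)) \<in> borel_measurable (weighted_measure \<alpha>)"
    by measurable
  have "cmod (f y * cnj (g y)) \<le> (cmod (f y))\<^sup>2 + (cmod (g y))\<^sup>2" for y
  proof -
    have "2 * (cmod (f y) * cmod (g y)) \<le> (cmod (f y))\<^sup>2 + (cmod (g y))\<^sup>2"
      using sum_squares_bound[of "cmod (f y)" "cmod (g y)"] by (simp add: mult.assoc)
    moreover have "0 \<le> cmod (f y) * cmod (g y)" by simp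
    ultimately show ?thesis unfolding norm_mult complex_mod_cnj by linarith
  qed
  then show "AE y in weighted_measure \<alpha>. norm (f y * cnj (g y)) \<le> norm ((cmod (f y))\<^sup>2 + (cmod (g y))\<^sup>2)"
    by (intro AE_I2) simp
qed

lemma L2_bounded:
  assumes [measurable]: "f \<in> borel_measurable borel" and B: "AE y in weighted_measure \<alpha>. cmod (f y) \<le> B"
  shows "f \<in> L2 \<alpha>"
proof -
  have "integrable (weighted_measure \<alpha>) (\<lambda>y. (cmod (f y))\<^sup>2)"
  proof (rule integrable_const_bound[where B = "B\<^sup>2"])
    show "AE y in weighted_measure \<alpha>. norm ((cmod (f y))\<^sup>2) \<le> B\<^sup>2"
      using B by eventually_elim (simp add: power_mono)
  qed measurable
  then show ?thesis by (simp add: L2_def)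
qed

lemma L2_integrable:
  assumes "f \<in> L2 \<alpha>"
  shows "integrable (weighted_measure \<alpha>) f"
  using L2_product_integrable[OF assms, of "\<lambda>_. 1"] L2_bounded[of "\<lambda>_. 1" 1] by simp

lemma L2_scale_sum:
  assumes "finite K" "\<And>k. k \<in> K \<Longrightarrow> \<phi> k \<in> L2 \<alpha>"
  shows "(\<lambda>x. \<Sum>k\<in>K. a k * \<phi> k x) \<in> L2 \<alpha>"
  using assms
proof (induction K rule: finite_induct)
  case empty
  show ?case by (simp add: L2_def)
next
  case (insert j K)
  let ?u = "\<lambda>x. a j * \<phi> j x" and ?v = "\<lambda>x. \<Sum>k\<in>K. a k * \<phi> k x"
  have v: "?v \<in> L2 \<alpha>" and p: "\<phi> j \<in> L2 \<alpha>" using insert by auto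
  then have [measurable]: "?v \<in> borel_measurable borel" "\<phi> j \<in> borel_measurable borel"
    by (simp_all add: L2_measurable)
  have "integrable (weighted_measure \<alpha>) (\<lambda>x. (cmod (?u x + ?v x))\<^sup>2)"
  proof (rule Bochner_Integration.integrable_bound)
    show "integrable (weighted_measure \<alpha>)
        (\<lambda>x. 2 * ((cmod (a j))\<^sup>2 * (cmod (\<phi> j x))\<^sup>2) + 2 * (cmod (?v x))\<^sup>2)"
      using L2_square_integrable[OF v] L2_square_integrable[OF p] by simp
    have "(cmod (w + z))\<^sup>2 \<le> 2 * (cmod w)\<^sup>2 + 2 * (cmod z)\<^sup>2" for w z
    proof -
      have "(cmod (w + z))\<^sup>2 \<le> (cmod w + cmod z)\<^sup>2"
        by (intro power_mono norm_triangle_ineq) simp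
      also have "\<dots> \<le> 2 * (cmod w)\<^sup>2 + 2 * (cmod z)\<^sup>2"
        using sum_squares_bound[of "cmod w" "cmod z"] by (simp add: power2_sum)
      finally show ?thesis .
    qed
    from this[of "?u _" "?v _"]
    show "AE x in weighted_measure \<alpha>. norm ((cmod (?u x + ?v x))\<^sup>2)
        \<le> norm (2 * ((cmod (a j))\<^sup>2 * (cmod (\<phi> j x))\<^sup>2) + 2 * (cmod (?v x))\<^sup>2)"
      by (intro AE_I2) (simp add: norm_mult power_mult_distrib)
  qed measurable
  with insert show ?case by (simp add: L2_def)
qed

lemma eigenspace_L2: "f \<in> eigenspace \<alpha> T z \<Longrightarrow> f \<in> L2 \<alpha>"
  by (simp add: eigenspace_def)

lemma L2_scale: "f \<in> L2 \<alpha> \<Longrightarrow> (\<lambda>x. a * f x) \<in> L2 \<alpha>"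
  using L2_scale_sum[of "{()}" "\<lambda>_. f" "\<lambda>_. a"] by simp

lemma L2_diff: "f \<in> L2 \<alpha> \<Longrightarrow> g \<in> L2 \<alpha> \<Longrightarrow> (\<lambda>x. f x - a * g x) \<in> L2 \<alpha>"
  using L2_scale_sum[of "UNIV :: bool set" "\<lambda>b. if b then f else g" "\<lambda>b. if b then 1 else - a"]
  by (simp add: UNIV_bool)

lemma L2_inner_sum:
  assumes "finite J" "finite K" and u: "\<And>j. j \<in> J \<Longrightarrow> u j \<in> L2 \<alpha>" and v: "\<And>k. k \<in> K \<Longrightarrow> v k \<in> L2 \<alpha>"
  shows "L2_inner \<alpha> (\<lambda>x. \<Sum>j\<in>J. a j * u j x) (\<lambda>x. \<Sum>k\<in>K. b k * v k x)
    = (\<Sum>j\<in>J. \<Sum>k\<in>K. a j * cnj (b k) * L2_inner \<alpha> (u j) (v k))"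
proof -
  have i: "integrable (weighted_measure \<alpha>) (\<lambda>x. a j * cnj (b k) * (u j x * cnj (v k x)))"
    if "j \<in> J" "k \<in> K" for j k
    using L2_product_integrable[OF u v, OF that] by simp
  have "(\<Sum>j\<in>J. a j * u j x) * cnj (\<Sum>k\<in>K. b k * v k x)
      = (\<Sum>j\<in>J. \<Sum>k\<in>K. a j * cnj (b k) * (u j x * cnj (v k x)))" for x
    by (simp add: sum_product mult_ac)
  then have "L2_inner \<alpha> (\<lambda>x. \<Sum>j\<in>J. a j * u j x) (\<lambda>x. \<Sum>k\<in>K. b k * v k x)
      = (LINT x|weighted_measure \<alpha>. (\<Sum>j\<in>J. \<Sum>k\<in>K. a j * cnj (b k) * (u j x * cnj (v k x))))"
    by (simp add: L2_inner_def)
  also have "\<dots> = (\<Sum>j\<in>J. \<Sum>k\<in>K. LINT x|weighted_measure \<alpha>. a j * cnj (b k) * (u j x * cnj (v k x)))"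
    using i by (simp add: Bochner_Integration.integral_sum)
  finally show ?thesis by (simp add: L2_inner_def)
qed

lemma L2_inner_commute: "L2_inner \<alpha> g f = cnj (L2_inner \<alpha> f g)"
proof -
  have "L2_inner \<alpha> g f = (LINT y|weighted_measure \<alpha>. cnj (f y * cnj (g y)))"
    by (simp add: L2_inner_def mult.commute)
  then show ?thesis by (simp only: L2_inner_def Bochner_Integration.integral_cnj)
qed

lemma L2_inner_self: "L2_inner \<alpha> f f = of_real (LINT y|weighted_measure \<alpha>. (cmod (f y))\<^sup>2)"
  unfolding L2_inner_def by (simp add: complex_norm_square[symmetric] flip: of_real_power)

lemma L2_inner_self_eq_0_iff:
  assumes "f \<in> L2 \<alpha>"
  shows "L2_inner \<alpha> f f = 0 \<longleftrightarrow> (AE y in weighted_measure \<alpha>. f y = 0)"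
  using integral_nonneg_eq_0_iff_AE[OF L2_square_integrable[OF assms]]
  by (simp add: L2_inner_self)

lemma L2_inner_cong_AE:
  assumes "f \<in> L2 \<alpha>" "f' \<in> L2 \<alpha>" "g \<in> L2 \<alpha>" "g' \<in> L2 \<alpha>"
    and "AE y in weighted_measure \<alpha>. f y = f' y" "AE y in weighted_measure \<alpha>. g y = g' y"
  shows "L2_inner \<alpha> f g = L2_inner \<alpha> f' g'"
proof -
  have [measurable]: "f \<in> borel_measurable borel" "f' \<in> borel_measurable borel"
      "g \<in> borel_measurable borel" "g' \<in> borel_measurable borel"
    using assms by (simp_all add: L2_measurable)
  show ?thesis
    unfolding L2_inner_def
  proof (rule integral_cong_AE)
    show "AE y in weighted_measure \<alpha>. f y * cnj (g y) = f' y * cnj (g' y)"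
      using assms(5,6) by eventually_elim simp
  qed measurable
qed

lemma L2_inner_scale:
  "L2_inner \<alpha> (\<lambda>x. a * f x) (\<lambda>x. b * g x) = a * cnj b * L2_inner \<alpha> f g"
proof -
  have "L2_inner \<alpha> (\<lambda>x. a * f x) (\<lambda>x. b * g x)
      = (LINT x|weighted_measure \<alpha>. (a * cnj b) * (f x * cnj (g x)))"
    by (simp add: L2_inner_def mult_ac)
  then show ?thesis by (simp add: L2_inner_def)
qed


section \<open>The finite Fourier transform\<close>

lemma finite_fourier_eq:
  assumes [measurable]: "f \<in> borel_measurable borel"
  shows "finite_fourier \<alpha> c f x
    = (LINT y|weighted_measure \<alpha>. exp (\<i> * of_real (c * x * y)) * f y)"
  unfolding finite_fourier_def set_lebesgue_integral_def
  by (subst integral_weighted_measure)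
     (auto intro!: Bochner_Integration.integral_cong simp: scaleR_conv_of_real split: split_indicator)

lemma kernel_integrable:
  assumes "f \<in> L2 \<alpha>"
  shows "integrable (weighted_measure \<alpha>) (\<lambda>y. exp (\<i> * of_real (c * x * y)) * f y)"
proof -
  have [measurable]: "f \<in> borel_measurable borel"
    using assms by (simp add: L2_measurable)
  show ?thesis
    by (rule Bochner_Integration.integrable_bound[OF L2_integrable[OF assms]])
       (auto simp: norm_mult)
qed

lemma finite_fourier_in_L2:
  assumes f: "f \<in> L2 \<alpha>"
  shows "finite_fourier \<alpha> c f \<in> L2 \<alpha>"
proof (rule L2_bounded)
  have [measurable]: "f \<in> borel_measurable borel"
    using f by (simp add: L2_measurable)
  show "finite_fourier \<alpha> c f \<in> borel_measurable borel"
    unfolding finite_fourier_eq[OF \<open>f \<in> borel_measurable borel\<close>, abs_def] by measurable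
  have "cmod (finite_fourier \<alpha> c f x) \<le> (LINT y|weighted_measure \<alpha>. cmod (f y))" for x
    using integral_norm_bound[of "weighted_measure \<alpha>" "\<lambda>y. exp (\<i> * of_real (c * x * y)) * f y"]
    by (simp add: finite_fourier_eq norm_mult)
  then show "AE x in weighted_measure \<alpha>. cmod (finite_fourier \<alpha> c f x) \<le> (LINT y|weighted_measure \<alpha>. cmod (f y))"
    by simp
qed

lemma finite_fourier_sum:
  assumes "finite K" "\<And>k. k \<in> K \<Longrightarrow> \<phi> k \<in> L2 \<alpha>"
  shows "finite_fourier \<alpha> c (\<lambda>x. \<Sum>k\<in>K. a k * \<phi> k x) = (\<lambda>x. \<Sum>k\<in>K. a k * finite_fourier \<alpha> c (\<phi> k) x)"
proof
  fix x
  let ?e = "\<lambda>y. exp (\<i> * complex_of_real (c * x * y))"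
  have "finite_fourier \<alpha> c (\<lambda>x. \<Sum>k\<in>K. a k * \<phi> k x) x
      = (LINT y|weighted_measure \<alpha>. ?e y * (\<Sum>k\<in>K. a k * \<phi> k y))"
    by (rule finite_fourier_eq, rule L2_measurable, rule L2_scale_sum) (use assms in auto)
  also have "\<dots> = (LINT y|weighted_measure \<alpha>. (\<Sum>k\<in>K. a k * (?e y * \<phi> k y)))"
    by (simp only: sum_distrib_left mult.left_commute)
  also have "\<dots> = (\<Sum>k\<in>K. LINT y|weighted_measure \<alpha>. a k * (?e y * \<phi> k y))"
    using kernel_integrable assms(2) by (intro Bochner_Integration.integral_sum) simp
  also have "\<dots> = (\<Sum>k\<in>K. a k * finite_fourier \<alpha> c (\<phi> k) x)"
    using assms(2) by (intro sum.cong) (simp_all add: finite_fourier_eq L2_measurable)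
  finally show "finite_fourier \<alpha> c (\<lambda>x. \<Sum>k\<in>K. a k * \<phi> k x) x
      = (\<Sum>k\<in>K. a k * finite_fourier \<alpha> c (\<phi> k) x)" .
qed

text \<open>The adjoint has the conjugate kernel, by Fubini's theorem.\<close>
lemma finite_fourier_adjoint:
  assumes f: "f \<in> L2 \<alpha>" and g: "g \<in> L2 \<alpha>"
  shows "L2_inner \<alpha> (finite_fourier \<alpha> c f) g = L2_inner \<alpha> f (finite_fourier \<alpha> (- c) g)"
proof -
  let ?M = "weighted_measure \<alpha>"
  have fm [measurable]: "f \<in> borel_measurable borel" and gm [measurable]: "g \<in> borel_measurable borel"
    using assms by (simp_all add: L2_measurable)
  let ?h = "\<lambda>x y. exp (\<i> * complex_of_real (c * x * y)) * f y * cnj (g x)"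
  have int: "integrable (?M \<Otimes>\<^sub>M ?M) (case_prod ?h)"
  proof (rule Fubini_integrable)
    have "integrable ?M (\<lambda>x. cmod (g x) * (LINT y|?M. cmod (f y)))"
      using L2_integrable[OF g] by simp
    then show "integrable ?M (\<lambda>x. LINT y|?M. norm (case_prod ?h (x, y)))"
      by (simp add: norm_mult mult.commute)
    have "integrable ?M (\<lambda>y. exp (\<i> * complex_of_real (c * x * y)) * f y * cnj (g x))" for x
      using kernel_integrable[OF f, of c x] by simp
    then show "AE x in ?M. integrable ?M (\<lambda>y. case_prod ?h (x, y))" by simp
  qed measurable
  have inner: "(LINT x|?M. ?h x y) = f y * cnj (finite_fourier \<alpha> (- c) g y)" for y
  proof -
    have "(LINT x|?M. ?h x y) = (LINT x|?M. f y * cnj (exp (\<i> * complex_of_real (- c * y * x)) * g x))"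
      by (simp add: exp_cnj mult_ac)
    also have "\<dots> = f y * (LINT x|?M. cnj (exp (\<i> * complex_of_real (- c * y * x)) * g x))"
      by (rule integral_mult_right_zero)
    finally show ?thesis by (simp only: Bochner_Integration.integral_cnj finite_fourier_eq[OF gm])
  qed
  have "L2_inner \<alpha> (finite_fourier \<alpha> c f) g = (LINT x|?M. LINT y|?M. ?h x y)"
    by (simp add: L2_inner_def finite_fourier_eq)
  also have "\<dots> = (LINT y|?M. LINT x|?M. ?h x y)"
    by (rule Fubini_integral[OF int, symmetric])
  also have "\<dots> = L2_inner \<alpha> f (finite_fourier \<alpha> (- c) g)"
    by (simp only: inner L2_inner_def)
  finally show ?thesis .
qed

text \<open>
  The adjoint is a choice among operators that agree almost everywhere. The one with the conjugate
  kernel shows that the choice is not empty, so that the chosen one has the defining property.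
\<close>
lemma L2_adjoint_finite_fourier:
  assumes f: "f \<in> L2 \<alpha>" and g: "g \<in> L2 \<alpha>"
  shows "L2_adjoint \<alpha> (finite_fourier \<alpha> c) g \<in> L2 \<alpha>"
    and "L2_inner \<alpha> (finite_fourier \<alpha> c f) g = L2_inner \<alpha> f (L2_adjoint \<alpha> (finite_fourier \<alpha> c) g)"
proof -
  have "\<exists>S. (\<forall>g\<in>L2 \<alpha>. S g \<in> L2 \<alpha>) \<and>
     (\<forall>f\<in>L2 \<alpha>. \<forall>g\<in>L2 \<alpha>. L2_inner \<alpha> (finite_fourier \<alpha> c f) g = L2_inner \<alpha> f (S g))"
    using finite_fourier_in_L2 finite_fourier_adjoint by (intro exI[of _ "finite_fourier \<alpha> (- c)"]) blast
  from someI_ex[OF this]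
  have "(\<forall>g\<in>L2 \<alpha>. L2_adjoint \<alpha> (finite_fourier \<alpha> c) g \<in> L2 \<alpha>) \<and>
     (\<forall>f\<in>L2 \<alpha>. \<forall>g\<in>L2 \<alpha>. L2_inner \<alpha> (finite_fourier \<alpha> c f) g = L2_inner \<alpha> f (L2_adjoint \<alpha> (finite_fourier \<alpha> c) g))"
    unfolding L2_adjoint_def[symmetric] .
  then show "L2_adjoint \<alpha> (finite_fourier \<alpha> c) g \<in> L2 \<alpha>"
    and "L2_inner \<alpha> (finite_fourier \<alpha> c f) g = L2_inner \<alpha> f (L2_adjoint \<alpha> (finite_fourier \<alpha> c) g)"
    using f g by blast+
qed

text \<open>
  Normality: the kernel with \<open>- c\<close> in place of \<open>c\<close> only reflects the value of the transform,
  and the measure is even.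
\<close>
lemma finite_fourier_normal:
  assumes f: "f \<in> L2 \<alpha>" and g: "g \<in> L2 \<alpha>"
  shows "L2_inner \<alpha> (finite_fourier \<alpha> (- c) f) (finite_fourier \<alpha> (- c) g)
    = L2_inner \<alpha> (finite_fourier \<alpha> c f) (finite_fourier \<alpha> c g)"
proof -
  have "finite_fourier \<alpha> (- c) h x = finite_fourier \<alpha> c h (- x)" for h x
    by (simp add: finite_fourier_def)
  moreover have [measurable]: "finite_fourier \<alpha> c f \<in> borel_measurable borel"
      "finite_fourier \<alpha> c g \<in> borel_measurable borel"
    using assms by (simp_all add: finite_fourier_in_L2 L2_measurable)
  ultimately show ?thesis
    using integral_weighted_measure_reflect[of "\<lambda>x. finite_fourier \<alpha> c f x * cnj (finite_fourier \<alpha> c g x)"]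
    by (simp add: L2_inner_def)
qed

lemma finite_fourier_eigenspace_inner:
  assumes f: "f \<in> eigenspace \<alpha> (finite_fourier \<alpha> c) z" and g: "g \<in> eigenspace \<alpha> (finite_fourier \<alpha> c) w"
  shows "L2_inner \<alpha> (finite_fourier \<alpha> c f) (finite_fourier \<alpha> c g) = z * cnj w * L2_inner \<alpha> f g"
proof -
  have "L2_inner \<alpha> (finite_fourier \<alpha> c f) (finite_fourier \<alpha> c g)
      = L2_inner \<alpha> (\<lambda>x. z * f x) (\<lambda>x. w * g x)"
    using assms by (intro L2_inner_cong_AE) (auto simp: eigenspace_def finite_fourier_in_L2 L2_scale)
  then show ?thesis by (simp add: L2_inner_scale)
qed

text \<open>
  A normal operator and its adjoint have the same eigenvectors, with conjugate eigenvalues: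
  normality makes the norm of the difference vanish.
\<close>
lemma finite_fourier_adjoint_eigenvector:
  assumes g: "g \<in> eigenspace \<alpha> (finite_fourier \<alpha> c) w"
  shows "AE x in weighted_measure \<alpha>. finite_fourier \<alpha> (- c) g x = cnj w * g x"
proof -
  have gL: "g \<in> L2 \<alpha>" using g by (rule eigenspace_L2)
  let ?A = "finite_fourier \<alpha> (- c) g"
  let ?d = "\<lambda>x. ?A x - cnj w * g x"
  have AL: "?A \<in> L2 \<alpha>" by (rule finite_fourier_in_L2[OF gL])
  have dL: "?d \<in> L2 \<alpha>" by (rule L2_diff[OF AL gL])
  have gA: "L2_inner \<alpha> g ?A = w * L2_inner \<alpha> g g"
  proof -
    have "L2_inner \<alpha> g ?A = L2_inner \<alpha> (finite_fourier \<alpha> c g) (\<lambda>x. 1 * g x)"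
      using finite_fourier_adjoint[OF gL gL, of c] by simp
    also have "\<dots> = L2_inner \<alpha> (\<lambda>x. w * g x) (\<lambda>x. 1 * g x)"
      using g gL by (intro L2_inner_cong_AE) (auto simp: eigenspace_def finite_fourier_in_L2 L2_scale)
    finally show ?thesis by (subst (asm) L2_inner_scale) simp
  qed
  have AA: "L2_inner \<alpha> ?A ?A = w * cnj w * L2_inner \<alpha> g g"
    using finite_fourier_normal[OF gL gL] finite_fourier_eigenspace_inner[OF g g] by simp
  have gg: "cnj (L2_inner \<alpha> g g) = L2_inner \<alpha> g g" by (metis L2_inner_commute)
  have Ag: "L2_inner \<alpha> ?A g = cnj w * L2_inner \<alpha> g g"
    by (metis L2_inner_commute gA gg complex_cnj_mult)
  have "L2_inner \<alpha> ?d ?d = L2_inner \<alpha> ?A ?A - w * L2_inner \<alpha> ?A g - cnj w * L2_inner \<alpha> g ?A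
      + cnj w * w * L2_inner \<alpha> g g"
    using L2_inner_sum[of "UNIV :: bool set" "UNIV :: bool set" "\<lambda>b. if b then ?A else g"
        "\<lambda>b. if b then ?A else g" "\<lambda>b. if b then 1 else - cnj w" "\<lambda>b. if b then 1 else - cnj w"] AL gL
    by (simp add: UNIV_bool algebra_simps)
  also have "\<dots> = 0"
    by (simp add: AA gA Ag)
  finally have "AE x in weighted_measure \<alpha>. ?d x = 0"
    using L2_inner_self_eq_0_iff[OF dL] by simp
  then show ?thesis by simp
qed

lemma finite_fourier_eigenspaces_orthogonal:
  assumes f: "f \<in> eigenspace \<alpha> (finite_fourier \<alpha> c) z" and g: "g \<in> eigenspace \<alpha> (finite_fourier \<alpha> c) w"
    and "z \<noteq> w"
  shows "L2_inner \<alpha> f g = 0"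
proof -
  have fL: "f \<in> L2 \<alpha>" and gL: "g \<in> L2 \<alpha>" using f g eigenspace_L2 by blast+
  have "z * L2_inner \<alpha> f g = L2_inner \<alpha> (\<lambda>x. z * f x) (\<lambda>x. 1 * g x)"
    by (subst L2_inner_scale) simp
  also have "\<dots> = L2_inner \<alpha> (finite_fourier \<alpha> c f) g"
    using f fL gL by (intro L2_inner_cong_AE) (auto simp: eigenspace_def finite_fourier_in_L2 L2_scale)
  also have "\<dots> = L2_inner \<alpha> f (finite_fourier \<alpha> (- c) g)"
    by (rule finite_fourier_adjoint[OF fL gL])
  also have "\<dots> = L2_inner \<alpha> (\<lambda>x. 1 * f x) (\<lambda>x. cnj w * g x)"
    using finite_fourier_adjoint_eigenvector[OF g] fL gL
    by (intro L2_inner_cong_AE) (auto simp: finite_fourier_in_L2 L2_scale)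
  also have "\<dots> = w * L2_inner \<alpha> f g"
    by (subst L2_inner_scale) simp
  finally show ?thesis using \<open>z \<noteq> w\<close> by simp
qed

text \<open>
  The form of \<open>Q\<close> is, up to the factor, the form of the transform. As the chosen adjoint need not be
  linear at every point, the form is used instead of combinations of values of \<open>Q\<close>.
\<close>
lemma Q_op_eigenspace_inner:
  assumes c: "c > 0" and f: "f \<in> L2 \<alpha>" and g: "g \<in> eigenspace \<alpha> (Q_op \<alpha> c) w"
  shows "L2_inner \<alpha> (finite_fourier \<alpha> c f) (finite_fourier \<alpha> c g) = of_real (2 * pi / c) * cnj w * L2_inner \<alpha> f g"
proof -
  have gL: "g \<in> L2 \<alpha>" using g by (rule eigenspace_L2)
  let ?A = "L2_adjoint \<alpha> (finite_fourier \<alpha> c) (finite_fourier \<alpha> c g)"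
  have "L2_inner \<alpha> (finite_fourier \<alpha> c f) (finite_fourier \<alpha> c g) = L2_inner \<alpha> (\<lambda>x. 1 * f x) ?A"
    using L2_adjoint_finite_fourier(2)[OF f finite_fourier_in_L2[OF gL]] by simp
  also have "\<dots> = L2_inner \<alpha> (\<lambda>x. 1 * f x) (\<lambda>x. of_real (2 * pi / c) * w * g x)"
  proof (rule L2_inner_cong_AE)
    show "?A \<in> L2 \<alpha>"
      by (rule L2_adjoint_finite_fourier(1)[OF f finite_fourier_in_L2[OF gL]])
    have "AE x in weighted_measure \<alpha>. Q_op \<alpha> c g x = w * g x"
      using g by (simp add: eigenspace_def)
    then show "AE x in weighted_measure \<alpha>. ?A x = of_real (2 * pi / c) * w * g x"
    proof eventually_elim
      case (elim x)
      have "?A x = of_real (2 * pi / c) * Q_op \<alpha> c g x"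
        using c by (simp add: Q_op_def)
      with elim show ?case by simp
    qed
  qed (use f gL L2_scale[OF f, of 1] L2_scale[OF gL, of "of_real (2 * pi / c) * w"] in simp_all)
  also have "\<dots> = of_real (2 * pi / c) * cnj w * L2_inner \<alpha> f g"
    by (subst L2_inner_scale) simp
  finally show ?thesis .
qed

lemma Q_op_eigenspaces_orthogonal:
  fixes z w :: real
  assumes c: "c > 0" and f: "f \<in> eigenspace \<alpha> (Q_op \<alpha> c) (of_real z)"
    and g: "g \<in> eigenspace \<alpha> (Q_op \<alpha> c) (of_real w)" and "z \<noteq> w"
  shows "L2_inner \<alpha> f g = 0"
proof -
  let ?F = "finite_fourier \<alpha> c"
  have fL: "f \<in> L2 \<alpha>" and gL: "g \<in> L2 \<alpha>" using f g eigenspace_L2 by blast+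
  have "of_real (2 * pi / c) * of_real w * L2_inner \<alpha> f g = L2_inner \<alpha> (?F f) (?F g)"
    using Q_op_eigenspace_inner[OF c fL g] by simp
  also have "\<dots> = cnj (L2_inner \<alpha> (?F g) (?F f))"
    by (rule L2_inner_commute)
  also have "\<dots> = of_real (2 * pi / c) * of_real z * L2_inner \<alpha> f g"
    unfolding Q_op_eigenspace_inner[OF c gL f] L2_inner_commute[of f g] by simp
  finally show ?thesis using \<open>z \<noteq> w\<close> c by simp
qed


section \<open>The transform of a function orthogonal to low powers\<close>

lemma power_in_L2: "(\<lambda>y. complex_of_real y ^ j) \<in> L2 \<alpha>"
proof (rule L2_bounded)
  show "AE y in weighted_measure \<alpha>. cmod (complex_of_real y ^ j) \<le> 1"
    using AE_weighted_measure_interval by eventually_elim (simp add: norm_power power_le_one)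
qed measurable

text \<open>
  Orthogonality permits to subtract from the exponential its polynomial approximation; the rest is
  the Cauchy--Schwarz inequality.
\<close>
lemma finite_fourier_pointwise_le:
  assumes f: "f \<in> L2 \<alpha>" and n: "n \<ge> 1"
    and orth: "\<And>j. j < n \<Longrightarrow> L2_inner \<alpha> f (\<lambda>y. of_real y ^ j) = 0"
  shows "(cmod (finite_fourier \<alpha> c f x))\<^sup>2
    \<le> 8 * ((\<bar>c * x\<bar> / 2) ^ n / fact n)\<^sup>2 * (LINT y|weighted_measure \<alpha>. (cmod (f y))\<^sup>2)"
proof -
  let ?M = "weighted_measure \<alpha>"
  let ?e = "\<lambda>y. exp (\<i> * complex_of_real (c * x * y))"
  define E where "E = 2 * (\<bar>c * x\<bar> / 2) ^ n / fact n"
  have E: "E \<ge> 0" by (simp add: E_def)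
  have [measurable]: "f \<in> borel_measurable borel"
    using f by (simp add: L2_measurable)
  obtain a where a: "\<And>y. \<bar>y\<bar> \<le> 1 \<Longrightarrow> cmod (?e y - (\<Sum>j<n. a j * of_real y ^ j)) \<le> E"
    using exp_poly_approx[OF n, of "c * x"] unfolding E_def by blast
  let ?p = "\<lambda>y. \<Sum>j<n. a j * complex_of_real y ^ j"
  have ie: "integrable ?M (\<lambda>y. ?e y * f y)"
    by (rule kernel_integrable[OF f])
  have ij: "integrable ?M (\<lambda>y. a j * (f y * of_real y ^ j))" for j
    using L2_product_integrable[OF f power_in_L2[of j]] by simp
  have pf: "?p y * f y = (\<Sum>j<n. a j * (f y * of_real y ^ j))" for y
    unfolding sum_distrib_right by (intro sum.cong refl) (simp only: mult_ac)
  have ip: "integrable ?M (\<lambda>y. ?p y * f y)"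
    unfolding pf using ij by (rule Bochner_Integration.integrable_sum)
  have "(LINT y|?M. ?p y * f y) = (\<Sum>j<n. LINT y|?M. a j * (f y * of_real y ^ j))"
    unfolding pf using ij by (rule Bochner_Integration.integral_sum)
  also have "\<dots> = (\<Sum>j<n. a j * L2_inner \<alpha> f (\<lambda>y. of_real y ^ j))"
    by (simp add: L2_inner_def)
  also have "\<dots> = 0" using orth by simp
  finally have "finite_fourier \<alpha> c f x = (LINT y|?M. ?e y * f y - ?p y * f y)"
    using ie ip by (simp add: finite_fourier_eq)
  then have "cmod (finite_fourier \<alpha> c f x) \<le> (LINT y|?M. cmod (?e y * f y - ?p y * f y))"
    by (simp only: integral_norm_bound)
  also have "\<dots> \<le> (LINT y|?M. E * cmod (f y))"
  proof (rule integral_mono_AE)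
    show "integrable ?M (\<lambda>y. cmod (?e y * f y - ?p y * f y))"
      using ie ip by (intro integrable_norm Bochner_Integration.integrable_diff)
    show "integrable ?M (\<lambda>y. E * cmod (f y))"
      using L2_integrable[OF f] by simp
    show "AE y in ?M. cmod (?e y * f y - ?p y * f y) \<le> E * cmod (f y)"
      using AE_weighted_measure_interval
    proof eventually_elim
      case (elim y)
      have "cmod (?e y * f y - ?p y * f y) = cmod (?e y - ?p y) * cmod (f y)"
        by (simp only: left_diff_distrib[symmetric] norm_mult)
      also have "\<dots> \<le> E * cmod (f y)" using a[OF elim] by (rule mult_right_mono) simp
      finally show ?case .
    qed
  qed
  also have "\<dots> = E * (LINT y|?M. cmod (f y))" by simp
  finally have "(cmod (finite_fourier \<alpha> c f x))\<^sup>2 \<le> E\<^sup>2 * (LINT y|?M. cmod (f y))\<^sup>2"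
    unfolding power_mult_distrib[symmetric] by (rule power_mono) simp
  also have "\<dots> \<le> E\<^sup>2 * (2 * (LINT y|?M. (cmod (f y))\<^sup>2))"
    using square_integral_le[OF \<alpha> integrable_norm[OF L2_integrable[OF f]] L2_square_integrable[OF f]]
    by (intro mult_left_mono) simp_all
  also have "\<dots> = 8 * ((\<bar>c * x\<bar> / 2) ^ n / fact n)\<^sup>2 * (LINT y|?M. (cmod (f y))\<^sup>2)"
    by (simp add: E_def power2_eq_square)
  finally show ?thesis .
qed

lemma finite_fourier_norm_le:
  assumes f: "f \<in> L2 \<alpha>" and n: "n \<ge> 1" and c: "c > 0"
    and orth: "\<And>j. j < n \<Longrightarrow> L2_inner \<alpha> f (\<lambda>y. of_real y ^ j) = 0"
  shows "(LINT x|weighted_measure \<alpha>. (cmod (finite_fourier \<alpha> c f x))\<^sup>2)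
    \<le> 8 * ((c / 2) ^ n / fact n)\<^sup>2 * (Gamma (\<alpha> + 1) * (real n - 1 / 2) powr (- \<alpha> - 1))
       * (LINT y|weighted_measure \<alpha>. (cmod (f y))\<^sup>2)"
proof -
  let ?M = "weighted_measure \<alpha>"
  define N where "N = (LINT y|?M. (cmod (f y))\<^sup>2)"
  define C where "C = 8 * ((c / 2) ^ n / fact n)\<^sup>2 * N"
  have N: "N \<ge> 0" unfolding N_def by (rule integral_nonneg_AE) simp
  have C: "C \<ge> 0" using N by (simp add: C_def)
  have "integrable ?M (\<lambda>x. x ^ (2 * n))"
  proof (rule integrable_const_bound[where B = 1])
    show "AE x in ?M. norm (x ^ (2 * n)) \<le> 1"
      using AE_weighted_measure_interval by eventually_elim (simp add: power_abs power_le_one)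
  qed measurable
  then have "(LINT x|?M. (cmod (finite_fourier \<alpha> c f x))\<^sup>2) \<le> (LINT x|?M. C * x ^ (2 * n))"
  proof (intro integral_mono_AE AE_I2)
    fix x
    have "(\<bar>c * x\<bar> / 2) ^ n = (c / 2) ^ n * \<bar>x\<bar> ^ n"
      using c by (simp add: abs_mult power_mult_distrib power_divide)
    then have "((\<bar>c * x\<bar> / 2) ^ n / fact n)\<^sup>2 = ((c / 2) ^ n / fact n)\<^sup>2 * x ^ (2 * n)"
      by (simp add: power_mult_distrib power_divide power_mult[symmetric] mult.commute[of n 2] power_even_abs)
    then show "(cmod (finite_fourier \<alpha> c f x))\<^sup>2 \<le> C * x ^ (2 * n)"
      using finite_fourier_pointwise_le[OF f n orth, of c x] by (simp add: C_def N_def mult_ac)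
  qed (use L2_square_integrable[OF finite_fourier_in_L2[OF f]] in simp_all)
  also have "\<dots> = C * (LINT x|?M. x ^ (2 * n))" by simp
  also have "\<dots> \<le> C * (Gamma (\<alpha> + 1) * (real n - 1 / 2) powr (- \<alpha> - 1))"
    by (rule mult_left_mono[OF even_moment_le[OF n \<alpha>] C])
  finally show ?thesis by (simp add: C_def N_def mult_ac)
qed


section \<open>Counting eigenfunctions\<close>

text \<open>
  Gaussian elimination: a pivot \<open>p\<close> in the row \<open>r\<close> removes one equation and one unknown.
\<close>
lemma homogeneous_system_solvable:
  fixes A :: "'r \<Rightarrow> 'k \<Rightarrow> 'a :: field"
  assumes "finite R" "finite K" "card R < card K"
  shows "\<exists>a. (\<exists>k\<in>K. a k \<noteq> 0) \<and> (\<forall>r\<in>R. (\<Sum>k\<in>K. A r k * a k) = 0)"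
  using assms
proof (induction R arbitrary: K A rule: finite_induct)
  case empty
  then obtain k where "k \<in> K" by fastforce
  then show ?case by (intro exI[of _ "\<lambda>_. 1"]) auto
next
  case (insert r R)
  show ?case
  proof (cases "\<forall>k\<in>K. A r k = 0")
    case True
    have "card R < card K" using insert by simp
    from insert.IH[OF insert.prems(1) this, of A] True show ?thesis by auto
  next
    case False
    then obtain p where p: "p \<in> K" "A r p \<noteq> 0" by blast
    define A' where "A' i k = A i k - A i p * A r k / A r p" for i k
    have "finite (K - {p})" "card R < card (K - {p})" using insert p by simp_all
    from insert.IH[OF this, of A'] obtain a where
      a: "\<exists>k\<in>K - {p}. a k \<noteq> 0" "\<And>i. i \<in> R \<Longrightarrow> (\<Sum>k\<in>K - {p}. A' i k * a k) = 0" by blast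
    define s where "s = (\<Sum>k\<in>K - {p}. A r k * a k)"
    define b where "b = a(p := - s / A r p)"
    have split: "(\<Sum>k\<in>K. A i k * b k) = A i p * (- s / A r p) + (\<Sum>k\<in>K - {p}. A i k * a k)" for i
    proof -
      have "(\<Sum>k\<in>K. A i k * b k) = A i p * b p + (\<Sum>k\<in>K - {p}. A i k * b k)"
        using insert.prems(1) p(1) by (rule sum.remove)
      also have "(\<Sum>k\<in>K - {p}. A i k * b k) = (\<Sum>k\<in>K - {p}. A i k * a k)"
        by (rule sum.cong) (simp_all add: b_def)
      finally show ?thesis by (simp add: b_def)
    qed
    have "(\<Sum>k\<in>K. A i k * b k) = 0" if "i \<in> R" for i
    proof -
      have "0 = (\<Sum>k\<in>K - {p}. A i k * a k - A i p / A r p * (A r k * a k))"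
        using a(2)[OF that] by (simp add: A'_def algebra_simps)
      also have "\<dots> = (\<Sum>k\<in>K - {p}. A i k * a k) - A i p / A r p * s"
        by (simp add: sum_subtractf sum_distrib_left s_def)
      finally show ?thesis by (simp add: split)
    qed
    moreover have "(\<Sum>k\<in>K. A r k * b k) = 0"
      using p by (simp add: split s_def)
    moreover have "\<exists>k\<in>K. b k \<noteq> 0"
      using a(1) by (auto simp: b_def)
    ultimately show ?thesis by (intro exI[of _ b]) auto
  qed
qed

text \<open>
  The bases of the eigenspaces, merged into one sequence that runs parallel to the eigenvalues. Only
  independence inside each eigenspace is recorded; between eigenspaces orthogonality gives it.
\<close>
lemma eigenfunctions_exist:
  assumes "enumerates_eigenvalues \<alpha> T \<mu>"
  shows "\<exists>\<phi>. (\<forall>k. \<phi> k \<in> eigenspace \<alpha> T (\<mu> k)) \<and>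
    (\<forall>z a. (AE x in weighted_measure \<alpha>. (\<Sum>k\<in>{k. \<mu> k = z}. a k * \<phi> k x) = 0) \<longrightarrow>
      (\<forall>k. \<mu> k = z \<longrightarrow> a k = 0))"
proof -
  let ?A = "\<lambda>z. {k. \<mu> k = z}"
  have fin: "finite (?A z)" for z
    using assms by (simp add: enumerates_eigenvalues_def)
  have "\<exists>b. (\<forall>k<card (?A z). b k \<in> eigenspace \<alpha> T z) \<and>
     (\<forall>a. (AE x in weighted_measure \<alpha>. (\<Sum>k<card (?A z). a k * b k x) = 0) \<longrightarrow> (\<forall>k<card (?A z). a k = 0))" for z
    using assms unfolding enumerates_eigenvalues_def has_L2_dim_def by meson
  then have "\<forall>z. \<exists>b. (\<forall>k<card (?A z). b k \<in> eigenspace \<alpha> T z) \<and>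
     (\<forall>a. (AE x in weighted_measure \<alpha>. (\<Sum>k<card (?A z). a k * b k x) = 0) \<longrightarrow> (\<forall>k<card (?A z). a k = 0))"
    by (rule allI)
  from choice[OF this] obtain b where
    b': "\<forall>z. (\<forall>k<card (?A z). b z k \<in> eigenspace \<alpha> T z) \<and>
     (\<forall>a. (AE x in weighted_measure \<alpha>. (\<Sum>k<card (?A z). a k * b z k x) = 0) \<longrightarrow> (\<forall>k<card (?A z). a k = 0))"
    by (elim exE)
  have b: "b z k \<in> eigenspace \<alpha> T z" if "k < card (?A z)" for z k
    using b'[THEN spec, of z, THEN conjunct1] that by simp
  have ind: "a k = 0" if "AE x in weighted_measure \<alpha>. (\<Sum>k<card (?A z). a k * b z k x) = 0"
      "k < card (?A z)" for z a k
    using b'[THEN spec, of z, THEN conjunct2, THEN spec, of a, THEN mp, OF that(1)] that(2) by simp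
  have "\<exists>h. bij_betw h (?A z) {..<card (?A z)}" for z
    using ex_bij_betw_finite_nat[OF fin] by (simp add: lessThan_atLeast0)
  then obtain h where h: "\<And>z. bij_betw (h z) (?A z) {..<card (?A z)}" by metis
  define \<phi> where "\<phi> k = b (\<mu> k) (h (\<mu> k) k)" for k
  have hk: "h (\<mu> k) k < card (?A (\<mu> k))" for k
    using bij_betwE[OF h[of "\<mu> k"]] by auto
  then have "\<phi> k \<in> eigenspace \<alpha> T (\<mu> k)" for k
    unfolding \<phi>_def by (rule b)
  moreover have "a k = 0"
    if ae: "AE x in weighted_measure \<alpha>. (\<Sum>k\<in>?A z. a k * \<phi> k x) = 0" and k: "\<mu> k = z" for z a k
  proof -
    let ?g = "the_inv_into (?A z) (h z)"
    have g: "?g (h z k) = k" if "\<mu> k = z" for k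
      using h[of z] that by (simp add: bij_betw_def the_inv_into_f_f)
    have "(\<Sum>k\<in>?A z. a k * \<phi> k x) = (\<Sum>i<card (?A z). a (?g i) * b z i x)" for x
    proof -
      have "(\<Sum>i<card (?A z). a (?g i) * b z i x) = (\<Sum>k\<in>?A z. a (?g (h z k)) * b z (h z k) x)"
        by (rule sum.reindex_bij_betw[OF h, symmetric])
      also have "\<dots> = (\<Sum>k\<in>?A z. a k * \<phi> k x)"
        using g by (intro sum.cong) (auto simp: \<phi>_def)
      finally show ?thesis ..
    qed
    with ae have "AE x in weighted_measure \<alpha>. (\<Sum>i<card (?A z). a (?g i) * b z i x) = 0" by simp
    then have "a (?g (h z k)) = 0"
      using hk[of k] k by (intro ind[where a = "\<lambda>i. a (?g i)"]) auto
    then show ?thesis using g k by simp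
  qed
  ultimately show ?thesis by blast
qed

lemma sum_block_diagonal:
  assumes "finite K" and zero: "\<And>j k. \<mu> j \<noteq> \<mu> k \<Longrightarrow> h j k = 0"
  shows "(\<Sum>j\<in>K. \<Sum>k\<in>K. h j k)
    = (\<Sum>z\<in>\<mu> ` K. \<Sum>j\<in>{k\<in>K. \<mu> k = z}. \<Sum>k\<in>{k\<in>K. \<mu> k = z}. h j k)"
proof -
  have inner: "(\<Sum>k\<in>K. h j k) = (\<Sum>k\<in>{k\<in>K. \<mu> k = z}. h j k)" if "\<mu> j = z" for j z
    using assms(1) zero[of j] that by (intro sum.mono_neutral_right) force+
  have "(\<Sum>j\<in>K. \<Sum>k\<in>K. h j k) = (\<Sum>z\<in>\<mu> ` K. \<Sum>j\<in>{k\<in>K. \<mu> k = z}. \<Sum>k\<in>K. h j k)"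
    by (rule sum.image_gen[OF assms(1)])
  also have "\<dots> = (\<Sum>z\<in>\<mu> ` K. \<Sum>j\<in>{k\<in>K. \<mu> k = z}. \<Sum>k\<in>{k\<in>K. \<mu> k = z}. h j k)"
    by (rule sum.cong[OF refl], rule sum.cong[OF refl], rule inner) simp
  finally show ?thesis .
qed

text \<open>
  The argument of Courant and Fischer. Among the combinations of the first \<open>n + 1\<close>
  eigenfunctions there is a nonzero one that satisfies the \<open>n\<close> conditions of orthogonality. Its
  components in the eigenspaces are orthogonal, and so are their transforms; hence the transform
  multiplies its squared norm by at least \<open>\<kappa> (\<mu> n)\<close>. The two hypotheses on inner products say that
  \<open>T\<close> diagonalizes the quadratic form of the transform, so that the lemma covers the transform itself
  as well as its product with its adjoint.
\<close>
lemma eigenvalue_le: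
  assumes enum: "enumerates_eigenvalues \<alpha> T \<mu>" and n: "n \<ge> 1" and c: "c > 0"
    and orth: "\<And>f g j k. f \<in> eigenspace \<alpha> T (\<mu> j) \<Longrightarrow> g \<in> eigenspace \<alpha> T (\<mu> k) \<Longrightarrow> \<mu> j \<noteq> \<mu> k \<Longrightarrow>
      L2_inner \<alpha> f g = 0"
    and inner: "\<And>f g j k. f \<in> eigenspace \<alpha> T (\<mu> j) \<Longrightarrow> g \<in> eigenspace \<alpha> T (\<mu> k) \<Longrightarrow>
      L2_inner \<alpha> (finite_fourier \<alpha> c f) (finite_fourier \<alpha> c g) = of_real (\<kappa> (\<mu> j)) * L2_inner \<alpha> f g"
    and least: "\<And>k. k \<le> n \<Longrightarrow> \<kappa> (\<mu> n) \<le> \<kappa> (\<mu> k)"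
  shows "\<kappa> (\<mu> n) \<le> 8 * ((c / 2) ^ n / fact n)\<^sup>2 * (Gamma (\<alpha> + 1) * (real n - 1 / 2) powr (- \<alpha> - 1))"
    (is "_ \<le> ?S")
proof -
  let ?M = "weighted_measure \<alpha>" and ?K = "{..n}" and ?F = "finite_fourier \<alpha> c"
  from eigenfunctions_exist[OF enum] obtain \<phi>
    where \<phi>': "\<forall>k. \<phi> k \<in> eigenspace \<alpha> T (\<mu> k)"
    and ind': "\<forall>z a. (AE x in ?M. (\<Sum>k\<in>{k. \<mu> k = z}. a k * \<phi> k x) = 0) \<longrightarrow> (\<forall>k. \<mu> k = z \<longrightarrow> a k = 0)"
    by (elim exE conjE)
  have \<phi>: "\<phi> k \<in> eigenspace \<alpha> T (\<mu> k)" for k using \<phi>' ..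
  have ind: "a k = 0" if "AE x in ?M. (\<Sum>k\<in>{k. \<mu> k = z}. a k * \<phi> k x) = 0" "\<mu> k = z" for z a k
    using ind'[rule_format, OF that] .
  have fin: "finite {k. \<mu> k = z}" for z
    using enum by (simp add: enumerates_eigenvalues_def)
  have L: "\<phi> k \<in> L2 \<alpha>" for k using eigenspace_L2[OF \<phi>] .
  obtain a where a: "\<exists>k\<le>n. a k \<noteq> 0"
    and eqs: "\<And>j. j < n \<Longrightarrow> (\<Sum>k\<le>n. L2_inner \<alpha> (\<phi> k) (\<lambda>y. of_real y ^ j) * a k) = 0"
    using homogeneous_system_solvable[of "{..<n}" ?K "\<lambda>j k. L2_inner \<alpha> (\<phi> k) (\<lambda>y. of_real y ^ j)"]
    by auto
  define f where "f x = (\<Sum>k\<le>n. a k * \<phi> k x)" for x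
  define A where "A z = {k \<in> ?K. \<mu> k = z}" for z
  define fz where "fz z x = (\<Sum>k\<in>A z. a k * \<phi> k x)" for z x
  have fL: "f \<in> L2 \<alpha>" unfolding f_def using L by (intro L2_scale_sum) auto
  have zL: "fz z \<in> L2 \<alpha>" for z
    unfolding fz_def A_def using L by (intro L2_scale_sum) auto
  define N where "N g = (LINT y|?M. (cmod (g y))\<^sup>2)" for g :: "real \<Rightarrow> complex"
  have N_inner: "L2_inner \<alpha> g g = of_real (N g)" for g
    unfolding N_def by (rule L2_inner_self)
  have N_nonneg: "N g \<ge> 0" for g unfolding N_def by (rule integral_nonneg_AE) simp
  have f_orth: "L2_inner \<alpha> f (\<lambda>y. of_real y ^ j) = 0" if "j < n" for j
    using L2_inner_sum[of ?K "{()}" \<phi> "\<lambda>_ y. of_real y ^ j" a "\<lambda>_. 1"] L power_in_L2 eqs[OF that]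
    by (simp add: f_def[abs_def] mult.commute)
  have Nz: "of_real (N (fz z)) = (\<Sum>j\<in>A z. \<Sum>k\<in>A z. a j * cnj (a k) * L2_inner \<alpha> (\<phi> j) (\<phi> k))" for z
    unfolding N_inner[symmetric] fz_def
    by (rule L2_inner_sum) (use L in \<open>auto simp: A_def\<close>)
  have "complex_of_real (N f) = (\<Sum>j\<le>n. \<Sum>k\<le>n. a j * cnj (a k) * L2_inner \<alpha> (\<phi> j) (\<phi> k))"
    unfolding N_inner[symmetric] f_def by (rule L2_inner_sum) (use L in auto)
  also have "\<dots> = (\<Sum>z\<in>\<mu> ` ?K. \<Sum>j\<in>A z. \<Sum>k\<in>A z. a j * cnj (a k) * L2_inner \<alpha> (\<phi> j) (\<phi> k))"
    unfolding A_def by (rule sum_block_diagonal) (simp_all add: orth[OF \<phi> \<phi>])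
  also have "\<dots> = of_real (\<Sum>z\<in>\<mu> ` ?K. N (fz z))"
    by (simp add: Nz)
  finally have Nf: "N f = (\<Sum>z\<in>\<mu> ` ?K. N (fz z))"
    by (simp only: of_real_eq_iff)
  have "?F f = (\<lambda>x. \<Sum>k\<le>n. a k * ?F (\<phi> k) x)"
    unfolding f_def using L by (intro finite_fourier_sum) auto
  then have "complex_of_real (N (?F f)) = L2_inner \<alpha> (\<lambda>x. \<Sum>k\<le>n. a k * ?F (\<phi> k) x) (\<lambda>x. \<Sum>k\<le>n. a k * ?F (\<phi> k) x)"
    by (simp add: N_inner)
  also have "\<dots> = (\<Sum>j\<le>n. \<Sum>k\<le>n. a j * cnj (a k) * L2_inner \<alpha> (?F (\<phi> j)) (?F (\<phi> k)))"
    by (rule L2_inner_sum) (use L finite_fourier_in_L2 in auto)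
  also have "\<dots> = (\<Sum>j\<le>n. \<Sum>k\<le>n. of_real (\<kappa> (\<mu> j)) * (a j * cnj (a k) * L2_inner \<alpha> (\<phi> j) (\<phi> k)))"
    by (simp add: inner[OF \<phi> \<phi>] mult_ac)
  also have "\<dots> = (\<Sum>z\<in>\<mu> ` ?K. \<Sum>j\<in>A z. \<Sum>k\<in>A z. of_real (\<kappa> (\<mu> j)) * (a j * cnj (a k) * L2_inner \<alpha> (\<phi> j) (\<phi> k)))"
    unfolding A_def by (rule sum_block_diagonal) (simp_all add: orth[OF \<phi> \<phi>])
  also have "\<dots> = (\<Sum>z\<in>\<mu> ` ?K. of_real (\<kappa> z) * of_real (N (fz z)))"
    unfolding Nz sum_distrib_left by (intro sum.cong refl) (simp add: A_def)
  also have "\<dots> = of_real (\<Sum>z\<in>\<mu> ` ?K. \<kappa> z * N (fz z))" by simp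
  finally have NF: "N (?F f) = (\<Sum>z\<in>\<mu> ` ?K. \<kappa> z * N (fz z))"
    by (simp only: of_real_eq_iff)
  have "\<kappa> (\<mu> n) * N f = (\<Sum>z\<in>\<mu> ` ?K. \<kappa> (\<mu> n) * N (fz z))"
    by (simp add: Nf sum_distrib_left)
  also have "\<dots> \<le> N (?F f)"
    unfolding NF using least N_nonneg by (intro sum_mono mult_right_mono) auto
  also have "\<dots> \<le> ?S * N f"
    unfolding N_def using finite_fourier_norm_le[OF fL n c f_orth] by simp
  finally have le: "\<kappa> (\<mu> n) * N f \<le> ?S * N f" .
  have "N f \<noteq> 0"
  proof
    assume "N f = 0"
    then have "N (fz z) = 0" if "z \<in> \<mu> ` ?K" for z
      using that N_nonneg by (auto simp: Nf sum_nonneg_eq_0_iff)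
    then have ae: "AE x in ?M. fz z x = 0" if "z \<in> \<mu> ` ?K" for z
      using that L2_inner_self_eq_0_iff[OF zL, of z] by (simp add: N_inner)
    obtain k where k: "k \<le> n" "a k \<noteq> 0" using a by blast
    let ?a = "\<lambda>k. if k \<le> n then a k else 0"
    have "fz (\<mu> k) x = (\<Sum>i\<in>{i. \<mu> i = \<mu> k}. ?a i * \<phi> i x)" for x
      unfolding fz_def using fin[of "\<mu> k"] by (intro sum.mono_neutral_cong_left) (auto simp: A_def)
    then have "AE x in ?M. (\<Sum>i\<in>{i. \<mu> i = \<mu> k}. ?a i * \<phi> i x) = 0"
      using ae[of "\<mu> k"] k(1) by simp
    from ind[OF this, of k] k show False by simp
  qed
  then show ?thesis using le N_nonneg[of f] by (simp add: mult_le_cancel_right)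
qed

end


section \<open>The explicit constants\<close>

text \<open>
  In terms of \<open>m = n - 1/2\<close> and \<open>q = exp 1 * c / (2 * m)\<close>, the factorial bound makes the left side at
  most \<open>4 * Gamma (\<alpha> + 1) * m powr (- \<alpha> - 2) * q ^ (2 * n)\<close>. The right side is the same with
  \<open>(pi / (q * ln (1 / q)))\<^sup>2\<close> in place of 4, so that \<open>q * ln (1 / q) \<le> 1\<close> and \<open>2 \<le> pi\<close> suffice.
\<close>
lemma squared_bound_ge:
  fixes c \<alpha> :: real
  assumes c: "c > 0" and \<alpha>: "\<alpha> \<ge> 0" and n: "real n > (exp 1 * c + 1) / 2"
  defines "B \<equiv> k_const \<alpha> / (c powr (\<alpha> / 2 + 1) * ln ((2 * real n - 1) / (exp 1 * c)))
             * (exp 1 * c / (2 * real n - 1)) powr (real n + \<alpha> / 2)"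
  shows "B \<ge> 0"
    and "8 * ((c / 2) ^ n / fact n)\<^sup>2 * (Gamma (\<alpha> + 1) * (real n - 1 / 2) powr (- \<alpha> - 1)) \<le> B\<^sup>2"
proof -
  define m where "m = real n - 1 / 2"
  define q where "q = exp 1 * c / (2 * m)"
  define p where "p = 1 + \<alpha> / 2"
  define G where "G = Gamma (\<alpha> + 1)"
  have ec: "0 < exp 1 * c" using c by simp
  with n have m: "m > 0" and m2: "2 * m > exp 1 * c" by (simp_all add: m_def)
  have n1: "n \<ge> 1" using m by (cases n) (simp_all add: m_def)
  have q: "0 < q" "q < 1" using ec m m2 by (simp_all add: q_def)
  have G: "G > 0" using \<alpha> Gamma_real_pos[of "\<alpha> + 1"] by (simp add: G_def)
  have twom: "2 * real n - 1 = 2 * m" by (simp add: m_def)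
  have "(2 * real n - 1) / (exp 1 * c) = inverse q" by (simp add: q_def twom)
  then have L: "ln ((2 * real n - 1) / (exp 1 * c)) = - ln q" by (simp add: ln_inverse)
  have lnq: "- ln q > 0" using q by simp
  have "ln (inverse q) \<le> inverse q - 1" using q by (intro ln_le_minus_one) simp
  then have "- ln q \<le> 1 / q" using q by (simp add: ln_inverse divide_inverse)
  then have qL: "q \<le> 1 / (- ln q)" using q lnq by (simp add: field_simps)
  \<comment> \<open>the powers of \<open>c\<close> cancel, since \<open>2 / exp 1 * q = c / m\<close>\<close>
  have B: "B = pi * sqrt G * m powr (- p) * q powr (real n - 1) * (1 / (- ln q))"
  proof -
    have "q powr (real n + \<alpha> / 2) = q powr (real n - 1) * q powr p"
      by (simp add: p_def powr_add[symmetric])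
    moreover have "(2 / exp 1) powr p * q powr p = m powr (- p) * c powr p"
    proof -
      have "(2 / exp 1) powr p * q powr p = (2 / exp 1 * q) powr p"
        using q by (subst powr_mult) simp_all
      also have "2 / exp 1 * q = c / m" by (simp add: q_def)
      also have "(c / m) powr p = m powr (- p) * c powr p"
        using c m by (simp add: powr_divide powr_minus field_simps)
      finally show ?thesis .
    qed
    moreover have "exp 1 * c / (2 * real n - 1) = q" by (simp add: q_def twom)
    moreover have "c powr (\<alpha> / 2 + 1) = c powr p" by (simp add: p_def add.commute)
    moreover have "k_const \<alpha> = (2 / exp 1) powr p * pi * sqrt G"
      using G by (simp add: k_const_def p_def G_def powr_half_sqrt)
    ultimately have "B = (2 / exp 1) powr p * pi * sqrt G / (c powr p * (- ln q)) * (q powr (real n - 1) * q powr p)"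
      unfolding B_def L by simp
    also have "\<dots> = ((2 / exp 1) powr p * q powr p) * pi * sqrt G / (c powr p * (- ln q)) * q powr (real n - 1)"
      by (simp add: mult_ac)
    also have "\<dots> = (m powr (- p) * c powr p) * pi * sqrt G / (c powr p * (- ln q)) * q powr (real n - 1)"
      by (simp only: \<open>(2 / exp 1) powr p * q powr p = m powr (- p) * c powr p\<close>)
    also have "\<dots> = pi * sqrt G * m powr (- p) * q powr (real n - 1) * (1 / (- ln q))"
      using c lnq by (simp add: field_simps)
    finally show ?thesis .
  qed
  show "B \<ge> 0" unfolding B using lnq G by (intro mult_nonneg_nonneg) simp_all
  define B0 where "B0 = pi * sqrt G * m powr (- p) * q ^ n"
  have qn: "q powr (real n - 1) * q = q ^ n"
    using q n1 by (simp add: powr_diff powr_realpow)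
  have "B0 = pi * sqrt G * m powr (- p) * q powr (real n - 1) * q"
    by (simp only: B0_def qn mult.assoc)
  also have "\<dots> \<le> B"
    unfolding B using qL G by (intro mult_left_mono) simp_all
  finally have "B0 \<le> B" .
  have "m * (m / exp 1) ^ (2 * n) * 2 \<le> (fact n)\<^sup>2"
    using fact_squared_ge[OF n1, folded m_def] by (simp only: mult_ac)
  then have "((c / 2) ^ n / fact n)\<^sup>2 \<le> ((c / 2) ^ n)\<^sup>2 / (m * (m / exp 1) ^ (2 * n) * 2)"
    unfolding power_divide using m by (intro divide_left_mono mult_pos_pos) simp_all
  also have "((c / 2) ^ n)\<^sup>2 = q ^ (2 * n) * (m / exp 1) ^ (2 * n)"
    using m by (simp add: power_mult_distrib[symmetric] q_def power_mult[symmetric] mult.commute[of n])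
  also have "q ^ (2 * n) * (m / exp 1) ^ (2 * n) / (m * (m / exp 1) ^ (2 * n) * 2) = q ^ (2 * n) / (2 * m)"
    using m by simp
  finally have "8 * ((c / 2) ^ n / fact n)\<^sup>2 * (G * m powr (- \<alpha> - 1))
      \<le> 8 * (q ^ (2 * n) / (2 * m)) * (G * m powr (- \<alpha> - 1))"
    using G by (intro mult_right_mono mult_left_mono) simp_all
  also have "\<dots> = 2\<^sup>2 * (G * m powr (- (2 * p)) * q ^ (2 * n))"
  proof -
    have mp: "m powr (- (2 * p)) = m powr (- \<alpha> - 1) / m"
    proof -
      have "- (2 * p) = (- \<alpha> - 1) - 1" by (simp add: p_def)
      then have "m powr (- (2 * p)) = m powr (- \<alpha> - 1) / m powr 1" by (simp only: powr_diff)
      then show ?thesis using m by simp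
    qed
    then show ?thesis unfolding mp using m by (simp add: field_simps)
  qed
  also have "\<dots> \<le> pi\<^sup>2 * (G * m powr (- (2 * p)) * q ^ (2 * n))"
    using G q pi_ge_two by (intro mult_right_mono power_mono) simp_all
  also have "\<dots> = B0\<^sup>2"
  proof -
    have "(m powr (- p))\<^sup>2 = m powr (- (2 * p))"
      by (simp add: power2_eq_square flip: powr_add)
    then show ?thesis
      using G by (simp add: B0_def power_mult_distrib power_mult[symmetric] mult.commute[of n])
  qed
  also have "\<dots> \<le> B\<^sup>2"
    using \<open>B0 \<le> B\<close> G q by (intro power_mono) (simp_all add: B0_def)
  finally show "8 * ((c / 2) ^ n / fact n)\<^sup>2 * (Gamma (\<alpha> + 1) * (real n - 1 / 2) powr (- \<alpha> - 1)) \<le> B\<^sup>2"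
    by (simp add: G_def m_def)
qed

lemma K_const_bound_eq:
  fixes c \<alpha> :: real
  assumes "c > 0" and "\<alpha> \<ge> 0"
  shows "c / (2 * pi) * (k_const \<alpha> / (c powr (\<alpha> / 2 + 1) * L) * q powr (r + \<alpha> / 2))\<^sup>2
    = K_const \<alpha> / (c powr (\<alpha> + 1) * L\<^sup>2) * q powr (2 * r + \<alpha>)"
proof -
  define X where "X = c powr (\<alpha> + 1)"
  have sq: "(x powr s)\<^sup>2 = x powr (2 * s)" for x s :: real
    by (cases "x = 0") (simp_all add: power2_eq_square powr_add[symmetric])
  have G: "Gamma (\<alpha> + 1) > 0" using assms Gamma_real_pos[of "\<alpha> + 1"] by simp
  have k: "(k_const \<alpha>)\<^sup>2 = (2 / exp 1) powr (\<alpha> + 2) * pi\<^sup>2 * Gamma (\<alpha> + 1)"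
    using G by (simp add: k_const_def power_mult_distrib sq add.commute)
  have qq: "(q powr (r + \<alpha> / 2))\<^sup>2 = q powr (2 * r + \<alpha>)"
    by (simp add: sq)
  have cp: "(c powr (\<alpha> / 2 + 1))\<^sup>2 = c * c powr (\<alpha> + 1)"
  proof -
    have "2 * (\<alpha> / 2 + 1) = 1 + (\<alpha> + 1)" by simp
    then have "(c powr (\<alpha> / 2 + 1))\<^sup>2 = c powr 1 * c powr (\<alpha> + 1)"
      unfolding sq by (simp only: powr_add)
    then show ?thesis using assms by simp
  qed
  have "c / (2 * pi) * (k_const \<alpha> / (c powr (\<alpha> / 2 + 1) * L) * q powr (r + \<alpha> / 2))\<^sup>2
      = c / (2 * pi) * ((2 / exp 1) powr (\<alpha> + 2) * pi\<^sup>2 * Gamma (\<alpha> + 1)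
          / (c * c powr (\<alpha> + 1) * L\<^sup>2) * q powr (2 * r + \<alpha>))"
    by (simp only: power_mult_distrib power_divide k cp qq)
  also have "\<dots> = K_const \<alpha> / (c powr (\<alpha> + 1) * L\<^sup>2) * q powr (2 * r + \<alpha>)"
    using assms unfolding K_const_def X_def[symmetric] by (simp add: power2_eq_square)
  finally show ?thesis .
qed

theorem theorem2:
  fixes c \<alpha> :: real and n :: nat
  assumes "c > 0" and "\<alpha> \<ge> 0" and "real n > (exp 1 * c + 1) / 2"
  shows "(\<forall>\<mu>. eigenvalues_finite_fourier \<alpha> c \<mu> \<longrightarrow>
           cmod (\<mu> n) \<le> k_const \<alpha> / (c powr (\<alpha> / 2 + 1) * ln ((2 * real n - 1) / (exp 1 * c)))
             * (exp 1 * c / (2 * real n - 1)) powr (real n + \<alpha> / 2))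
       \<and> (\<forall>\<nu>. eigenvalues_Q_op \<alpha> c \<nu> \<longrightarrow>
           \<nu> n \<le> K_const \<alpha> / (c powr (\<alpha> + 1) * (ln ((2 * real n - 1) / (exp 1 * c)))\<^sup>2)
             * (exp 1 * c / (2 * real n - 1)) powr (2 * real n + \<alpha>))"
proof (intro conjI allI impI)
  have "0 < (exp 1 * c + 1) / 2" using assms(1) by (simp add: add_pos_pos)
  from less_trans[OF this assms(3)] have "real n > 0" .
  then have n: "n \<ge> 1" by simp
  note bound = squared_bound_ge[OF assms]
  note inner_F = finite_fourier_eigenspace_inner[OF assms(2)]
  note orth_F = finite_fourier_eigenspaces_orthogonal[OF assms(2)]
  note inner_Q = Q_op_eigenspace_inner[OF assms(2,1)]
  note orth_Q = Q_op_eigenspaces_orthogonal[OF assms(2,1)]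
  {
    fix \<mu> assume "eigenvalues_finite_fourier \<alpha> c \<mu>"
    then have enum: "enumerates_eigenvalues \<alpha> (finite_fourier \<alpha> c) \<mu>" and dec: "decseq (\<lambda>n. cmod (\<mu> n))"
      by (simp_all add: eigenvalues_finite_fourier_def)
    have "(cmod (\<mu> n))\<^sup>2 \<le> 8 * ((c / 2) ^ n / fact n)\<^sup>2 * (Gamma (\<alpha> + 1) * (real n - 1 / 2) powr (- \<alpha> - 1))"
    proof (rule eigenvalue_le[OF assms(2) enum n assms(1), where \<kappa> = "\<lambda>z. (cmod z)\<^sup>2"])
      fix f g j k
      assume fg: "f \<in> eigenspace \<alpha> (finite_fourier \<alpha> c) (\<mu> j)" "g \<in> eigenspace \<alpha> (finite_fourier \<alpha> c) (\<mu> k)"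
      then show "L2_inner \<alpha> (finite_fourier \<alpha> c f) (finite_fourier \<alpha> c g)
          = complex_of_real ((cmod (\<mu> j))\<^sup>2) * L2_inner \<alpha> f g"
        using inner_F[OF fg] orth_F[OF fg] complex_norm_square[of "\<mu> j"]
        by (cases "\<mu> j = \<mu> k") simp_all
    next
      show "(cmod (\<mu> n))\<^sup>2 \<le> (cmod (\<mu> k))\<^sup>2" if "k \<le> n" for k
        using decseqD[OF dec that] by (simp add: power_mono)
    qed (rule orth_F)
    from order_trans[OF this bound(2)]
    show "cmod (\<mu> n) \<le> k_const \<alpha> / (c powr (\<alpha> / 2 + 1) * ln ((2 * real n - 1) / (exp 1 * c)))
             * (exp 1 * c / (2 * real n - 1)) powr (real n + \<alpha> / 2)"
      by (rule power2_le_imp_le) (rule bound(1))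
  next
    fix \<nu> assume "eigenvalues_Q_op \<alpha> c \<nu>"
    then have enum: "enumerates_eigenvalues \<alpha> (Q_op \<alpha> c) (\<lambda>n. complex_of_real (\<nu> n))" and dec: "decseq \<nu>"
      by (simp_all add: eigenvalues_Q_op_def)
    have "2 * pi / c * Re (complex_of_real (\<nu> n))
        \<le> 8 * ((c / 2) ^ n / fact n)\<^sup>2 * (Gamma (\<alpha> + 1) * (real n - 1 / 2) powr (- \<alpha> - 1))"
    proof (rule eigenvalue_le[OF assms(2) enum n assms(1), where \<kappa> = "\<lambda>z. 2 * pi / c * Re z"])
      fix f g j k
      assume fg: "f \<in> eigenspace \<alpha> (Q_op \<alpha> c) (complex_of_real (\<nu> j))"
        "g \<in> eigenspace \<alpha> (Q_op \<alpha> c) (complex_of_real (\<nu> k))"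
      then show "L2_inner \<alpha> (finite_fourier \<alpha> c f) (finite_fourier \<alpha> c g)
          = complex_of_real (2 * pi / c * Re (complex_of_real (\<nu> j))) * L2_inner \<alpha> f g"
        using inner_Q[OF eigenspace_L2[OF assms(2) fg(1)] fg(2)] orth_Q[OF fg]
        by (cases "\<nu> j = \<nu> k") simp_all
      show "L2_inner \<alpha> f g = 0" if "complex_of_real (\<nu> j) \<noteq> complex_of_real (\<nu> k)"
        using orth_Q[OF fg] that by simp
    next
      show "2 * pi / c * Re (complex_of_real (\<nu> n)) \<le> 2 * pi / c * Re (complex_of_real (\<nu> k))" if "k \<le> n" for k
        using decseqD[OF dec that] assms(1) by (intro mult_left_mono) simp_all
    qed
    then have "2 * pi / c * \<nu> n \<le> (k_const \<alpha> / (c powr (\<alpha> / 2 + 1) * ln ((2 * real n - 1) / (exp 1 * c)))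
             * (exp 1 * c / (2 * real n - 1)) powr (real n + \<alpha> / 2))\<^sup>2"
      unfolding Re_complex_of_real using bound(2) by (rule order_trans)
    then have "c / (2 * pi) * (2 * pi / c * \<nu> n) \<le> c / (2 * pi) * (k_const \<alpha> / (c powr (\<alpha> / 2 + 1) * ln ((2 * real n - 1) / (exp 1 * c)))
             * (exp 1 * c / (2 * real n - 1)) powr (real n + \<alpha> / 2))\<^sup>2"
      using assms(1) by (intro mult_left_mono) simp_all
    moreover have "c / (2 * pi) * (2 * pi / c * \<nu> n) = \<nu> n"
      using assms(1) by simp
    ultimately have "\<nu> n \<le> c / (2 * pi) * (k_const \<alpha> / (c powr (\<alpha> / 2 + 1) * ln ((2 * real n - 1) / (exp 1 * c)))
             * (exp 1 * c / (2 * real n - 1)) powr (real n + \<alpha> / 2))\<^sup>2"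
      by (simp only:)
    then show "\<nu> n \<le> K_const \<alpha> / (c powr (\<alpha> + 1) * (ln ((2 * real n - 1) / (exp 1 * c)))\<^sup>2)
             * (exp 1 * c / (2 * real n - 1)) powr (2 * real n + \<alpha>)"
      by (simp only: K_const_bound_eq[OF assms(1,2)])
  }
qed

end
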